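(* Let $(\mathcal{L},\Delta,\epsilon)$ be a complex coalgebra, let $\Psi_0:\mathcal{L}\otimes\mathcal{L}\to\mathcal{L}\otimes\mathcal{L}$ be a compatible braiding, and let $[\ ,\ ]:\mathcal{L}\otimes\mathcal{L}\to\mathcal{L}$ be a linear map. If $[\ ,\ ]$ defines a braided Lie algebra, then $$\Psi=([\ ,\ ]\otimes\mathrm{id})\circ(\mathrm{id}\otimes\Psi_0)\circ(\Delta\otimes\mathrm{id}):\mathcal{L}\otimes\mathcal{L}\to\mathcal{L}\otimes\mathcal{L}$$ is a braiding. The braided enveloping algebra $U(\mathcal{L})$ is generated by $1$ and $\mathcal{L}$ with the relations $\cdot\circ\Psi=\cdot$ (on $\mathcal{L}\otimes\mathcal{L}$) of braided commutativity.
   Context: A braiding on a vector space $W$ is a linear map $\Psi:W\otimes W\to W\otimes W$ with $\Psi_{23}\Psi_{12}\Psi_{23}=\Psi_{12}\Psi_{23}\Psi_{12}$ on $W^{\otimes 3}$, where $\Psi_{12}=\Psi\otimes\mathrm{id}$, $\Psi_{23}=\mathrm{id}\otimes\Psi$. The coalgebra is coassociative with counit $\epsilon:\mathcal{L}\to\mathbb{C}$. Compatibility means that the structure maps commute with the background braiding $\Psi_0$ (functoriality): writing $\Psi_0$ with leg indices, $(\mathrm{id}\otimes\Delta)\Psi_0=(\Psi_0)_{12}(\Psi_0)_{23}(\Delta\otimes\mathrm{id})$, $(\Delta\otimes\mathrm{id})\Psi_0=(\Psi_0)_{23}(\Psi_0)_{12}(\mathrm{id}\otimes\Delta)$, $(\mathrm{id}\otimes\epsilon)\Psi_0=\epsilon\otimes\mathrm{id}$,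 $(\epsilon\otimes\mathrm{id})\Psi_0=\mathrm{id}\otimes\epsilon$, and likewise for the bracket: $\Psi_0([\ ,\ ]\otimes\mathrm{id})=(\mathrm{id}\otimes[\ ,\ ])(\Psi_0)_{12}(\Psi_0)_{23}$, $\Psi_0(\mathrm{id}\otimes[\ ,\ ])=([\ ,\ ]\otimes\mathrm{id})(\Psi_0)_{23}(\Psi_0)_{12}$. A braided Lie algebra is a coalgebra $(\mathcal{L},\Delta,\epsilon)$ with a braiding $\Psi_0$ and a map $[\ ,\ ]:\mathcal{L}\otimes\mathcal{L}\to\mathcal{L}$, where $\Delta$, $\epsilon$ and $[\ ,\ ]$ all commute with $\Psi_0$, i.e. $(\mathrm{id}\otimes\Delta)\Psi_0=(\Psi_0)_{12}(\Psi_0)_{23}(\Delta\otimes\mathrm{id})$, $(\Delta\otimes\mathrm{id})\Psi_0=(\Psi_0)_{23}(\Psi_0)_{12}(\mathrm{id}\otimes\Delta)$, $(\mathrm{id}\otimes\epsilon)\Psi_0=\epsilon\otimes\mathrm{id}$, $(\epsilon\otimes\mathrm{id})\Psi_0=\mathrm{id}\otimes\epsilon$, $\Psi_0([\ ,\ ]\otimes\mathrm{id})=(\mathrm{id}\otimes[\ ,\ ])(\Psi_0)_{12}(\Psi_0)_{23}$ and $\Psi_0(\mathrm{id}\otimes[\ ,\ ])=([\ ,\ ]\otimes\mathrm{id})(\Psi_0)_{23}(\Psi_0)_{12}$, such that (L1) (braided Jacobi identity) $[\ ,\ ]\circ(\mathrm{id}\otimes[\ ,\ ])=[\ ,\ ]\circ([\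 ,\ ]\otimes[\ ,\ ])\circ(\mathrm{id}\otimes\Psi_0\otimes\mathrm{id})\circ(\Delta\otimes\mathrm{id}\otimes\mathrm{id})$; (L2) (braided cocommutativity) $\Psi_0\circ([\ ,\ ]\otimes\mathrm{id})\circ(\mathrm{id}\otimes\Psi_0)\circ(\Delta\otimes\mathrm{id})=(\mathrm{id}\otimes[\ ,\ ])\circ(\Delta\otimes\mathrm{id})$; (L3) $\Delta\circ[\ ,\ ]=([\ ,\ ]\otimes[\ ,\ ])\circ(\mathrm{id}\otimes\Psi_0\otimes\mathrm{id})\circ(\Delta\otimes\Delta)$ and $\epsilon\circ[\ ,\ ]=\epsilon\otimes\epsilon$. The braided enveloping algebra $U(\mathcal{L})$ of a braided Lie algebra is the unital associative algebra generated by $\mathcal{L}$ with the relations $\cdot=\cdot\circ([\ ,\ ]\otimes\mathrm{id})\circ(\mathrm{id}\otimes\Psi_0)\circ(\Delta\otimes\mathrm{id})$ on $\mathcal{L}\otimes\mathcal{L}$, where $\cdot$ denotes the product. *)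

theory Defs
  imports
    Complex_Main
    "HOL-Library.Poly_Mapping"
    "HOL-Algebra.Module"
    "HOL-Algebra.QuotRing"
    "HOL-Algebra.Algebraic_Closure_Type"
begin

section \<open>Complex vector spaces and unital associative algebras\<close>

class complex_vector = ab_group_add +
  fixes scaleC :: "complex \<Rightarrow> 'a \<Rightarrow> 'a"  (infixr \<open>*\<^sub>C\<close> 75)
  assumes scaleC_add_right: "c *\<^sub>C (x + y) = c *\<^sub>C x + c *\<^sub>C y"
    and scaleC_add_left: "(c + d) *\<^sub>C x = c *\<^sub>C x + d *\<^sub>C x"
    and scaleC_scaleC: "c *\<^sub>C d *\<^sub>C x = (c * d) *\<^sub>C x"
    and scaleC_one: "1 *\<^sub>C x = x"

global_interpretation complex_vector: vector_space "scaleC :: complex \<Rightarrow> 'a \<Rightarrow> 'a::complex_vector"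
  by unfold_locales (simp_all add: scaleC_add_right scaleC_add_left scaleC_scaleC scaleC_one)

text \<open>The classes \<^class>\<open>ring\<close> and \<^class>\<open>monoid_mult\<close> are used instead of \<^class>\<open>ring_1\<close>,
  which would exclude the zero algebra.\<close>

class complex_algebra_1 = complex_vector + ring + monoid_mult +
  assumes mult_scaleC_left: "(c *\<^sub>C x) * y = c *\<^sub>C (x * y)"
    and mult_scaleC_right: "x * (c *\<^sub>C y) = c *\<^sub>C (x * y)"

abbreviation clinear :: "('a::complex_vector \<Rightarrow> 'b::complex_vector) \<Rightarrow> bool"
  where "clinear \<equiv> Vector_Spaces.linear scaleC scaleC"

lemma clinearI:
  assumes "\<And>x y. f (x + y) = f x + f y" "\<And>c x. f (c *\<^sub>C x) = c *\<^sub>C f x"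
  shows "clinear f"
  using assms by unfold_locales auto

lemma clinear_add: "clinear f \<Longrightarrow> f (x + y) = f x + f y"
  and clinear_scaleC: "clinear f \<Longrightarrow> f (c *\<^sub>C x) = c *\<^sub>C f x"
  and clinear_diff: "clinear f \<Longrightarrow> f (x - y) = f x - f y"
  and clinear_zero: "clinear f \<Longrightarrow> f 0 = 0"
  by (auto simp: Vector_Spaces.linear_def module_hom.add module_hom.scale module_hom.diff
      module_hom.zero)

lemma clinear_id: "clinear (\<lambda>x. x)"
  by (rule clinearI) auto

lemma clinear_compose: "clinear f \<Longrightarrow> clinear g \<Longrightarrow> clinear (\<lambda>x. f (g x))"
  by (rule clinearI) (auto simp: clinear_add clinear_scaleC)

definition cbilinear ::
    "('a::complex_vector \<Rightarrow> 'b::complex_vector \<Rightarrow> 'c::complex_vector) \<Rightarrow> bool"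
  where "cbilinear B \<longleftrightarrow> (\<forall>y. clinear (\<lambda>x. B x y)) \<and> (\<forall>x. clinear (B x))"

instantiation complex :: complex_algebra_1
begin
definition scaleC_complex :: "complex \<Rightarrow> complex \<Rightarrow> complex"
  where "scaleC_complex c x = c * x"
instance by standard (simp_all add: scaleC_complex_def algebra_simps)
end

text \<open>\<^typ>\<open>'k \<Rightarrow>\<^sub>0 complex\<close> is the vector space with basis \<^typ>\<open>'k\<close>; for an index monoid it is
  the monoid algebra.\<close>

instantiation poly_mapping :: (type, complex_vector) complex_vector
begin
definition scaleC_poly_mapping :: "complex \<Rightarrow> ('a \<Rightarrow>\<^sub>0 'b) \<Rightarrow> 'a \<Rightarrow>\<^sub>0 'b"
  where "scaleC_poly_mapping c p = Poly_Mapping.map (scaleC c) p"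
instance
proof -
  have *: "Poly_Mapping.lookup (c *\<^sub>C p) k = c *\<^sub>C Poly_Mapping.lookup p k"
    for c k and p :: "'a \<Rightarrow>\<^sub>0 'b"
    by (auto simp: scaleC_poly_mapping_def Poly_Mapping.map.rep_eq when_def)
  show "OFCLASS('a \<Rightarrow>\<^sub>0 'b, complex_vector_class)"
    by standard
      (auto simp: * scaleC_add_right scaleC_add_left scaleC_scaleC lookup_add intro!: poly_mapping_eqI)
qed
end

lemma lookup_scaleC: "Poly_Mapping.lookup (c *\<^sub>C p) k = c *\<^sub>C Poly_Mapping.lookup p k"
  by (auto simp: scaleC_poly_mapping_def Poly_Mapping.map.rep_eq when_def)

definition free_lift :: "('k \<Rightarrow> 'a::complex_vector) \<Rightarrow> ('k \<Rightarrow>\<^sub>0 complex) \<Rightarrow> 'a"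
  where "free_lift f p = (\<Sum>k\<in>Poly_Mapping.keys p. Poly_Mapping.lookup p k *\<^sub>C f k)"

lemma free_lift_superset:
  assumes "finite K" "Poly_Mapping.keys p \<subseteq> K"
  shows "free_lift f p = (\<Sum>k\<in>K. Poly_Mapping.lookup p k *\<^sub>C f k)"
  unfolding free_lift_def
  by (rule sum.mono_neutral_left) (use assms in \<open>auto simp: in_keys_iff\<close>)

lemma clinear_free_lift: "clinear (free_lift f)"
proof (rule clinearI)
  fix p q :: "'a \<Rightarrow>\<^sub>0 complex" and c
  let ?K = "Poly_Mapping.keys p \<union> Poly_Mapping.keys q"
  have "Poly_Mapping.keys (p + q) \<subseteq> ?K" by (rule keys_add)
  then show "free_lift f (p + q) = free_lift f p + free_lift f q"
    by (simp add: free_lift_superset[of ?K] lookup_add scaleC_add_left sum.distrib)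
  have "Poly_Mapping.keys (c *\<^sub>C p) \<subseteq> Poly_Mapping.keys p"
    by (auto simp: in_keys_iff lookup_scaleC)
  then show "free_lift f (c *\<^sub>C p) = c *\<^sub>C free_lift f p"
    by (simp add: free_lift_superset[of "Poly_Mapping.keys p"] lookup_scaleC complex_vector.scale_sum_right
        scaleC_complex_def scaleC_scaleC)
qed

lemma free_lift_single: "free_lift f (Poly_Mapping.single k c) = c *\<^sub>C f k"
  by (simp add: free_lift_superset[of "{k}"])


section \<open>Tensor products of vector spaces\<close>

definition bilinear_relations ::
    "('a::complex_vector \<times> 'b::complex_vector \<Rightarrow>\<^sub>0 complex) set"
  where "bilinear_relations =
    {Poly_Mapping.single (x + x', y) 1 - Poly_Mapping.single (x, y) 1
       - Poly_Mapping.single (x', y) 1 | x x' y. True} \<union>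
    {Poly_Mapping.single (x, y + y') 1 - Poly_Mapping.single (x, y) 1
       - Poly_Mapping.single (x, y') 1 | x y y'. True} \<union>
    {Poly_Mapping.single (c *\<^sub>C x, y) 1 - Poly_Mapping.single (x, y) c | c x y. True} \<union>
    {Poly_Mapping.single (x, c *\<^sub>C y) 1 - Poly_Mapping.single (x, y) c | c x y. True}"

definition tensor_eq ::
    "('a::complex_vector \<times> 'b::complex_vector \<Rightarrow>\<^sub>0 complex) \<Rightarrow> ('a \<times> 'b \<Rightarrow>\<^sub>0 complex) \<Rightarrow> bool"
  where "tensor_eq p q \<longleftrightarrow> p - q \<in> complex_vector.span bilinear_relations"

lemma span_eq_equivp:
  fixes S :: "'a::complex_vector set"
  shows "equivp (\<lambda>p q. p - q \<in> complex_vector.span S)"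
proof (rule equivpI)
  show "reflp (\<lambda>p q. p - q \<in> complex_vector.span S)"
    by (rule reflpI) (simp add: complex_vector.span_zero)
  show "symp (\<lambda>p q. p - q \<in> complex_vector.span S)"
    by (rule sympI) (metis complex_vector.span_neg minus_diff_eq)
  show "transp (\<lambda>p q. p - q \<in> complex_vector.span S)"
  proof (rule transpI)
    fix p q r assume "p - q \<in> complex_vector.span S" "q - r \<in> complex_vector.span S"
    from complex_vector.span_add[OF this] show "p - r \<in> complex_vector.span S" by simp
  qed
qed

quotient_type (overloaded) ('a, 'b) tensor =
    "'a::complex_vector \<times> 'b::complex_vector \<Rightarrow>\<^sub>0 complex" / tensor_eq
  unfolding tensor_eq_def by (rule span_eq_equivp)

type_notation tensor  (infixr \<open>\<otimes>\<close> 80)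

lemma span_congs:
  fixes S :: "'a::complex_vector set"
  shows "p - p' \<in> complex_vector.span S \<Longrightarrow> q - q' \<in> complex_vector.span S
      \<Longrightarrow> (p + q) - (p' + q') \<in> complex_vector.span S"
    and "p - p' \<in> complex_vector.span S \<Longrightarrow> q - q' \<in> complex_vector.span S
      \<Longrightarrow> (p - q) - (p' - q') \<in> complex_vector.span S"
    and "p - p' \<in> complex_vector.span S \<Longrightarrow> (- p) - (- p') \<in> complex_vector.span S"
    and "p - p' \<in> complex_vector.span S \<Longrightarrow> c *\<^sub>C p - c *\<^sub>C p' \<in> complex_vector.span S"
proof -
  assume *: "p - p' \<in> complex_vector.span S"
  show "(- p) - (- p') \<in> complex_vector.span S"
    using complex_vector.span_neg[OF *] by (simp add: algebra_simps)
  show "c *\<^sub>C p - c *\<^sub>C p' \<in> complex_vector.span S"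
    using complex_vector.span_scale[OF *, of c] by (simp add: complex_vector.scale_right_diff_distrib)
  assume **: "q - q' \<in> complex_vector.span S"
  show "(p + q) - (p' + q') \<in> complex_vector.span S"
    using complex_vector.span_add[OF * **] by (simp add: algebra_simps)
  show "(p - q) - (p' - q') \<in> complex_vector.span S"
    using complex_vector.span_diff[OF * **] by (simp add: algebra_simps)
qed

instantiation tensor :: (complex_vector, complex_vector) complex_vector
begin
lift_definition zero_tensor :: "'a \<otimes> 'b" is 0 .
lift_definition plus_tensor :: "'a \<otimes> 'b \<Rightarrow> 'a \<otimes> 'b \<Rightarrow> 'a \<otimes> 'b" is "(+)"
  unfolding tensor_eq_def by (rule span_congs)
lift_definition minus_tensor :: "'a \<otimes> 'b \<Rightarrow> 'a \<otimes> 'b \<Rightarrow> 'a \<otimes> 'b" is "(-)"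
  unfolding tensor_eq_def by (rule span_congs)
lift_definition uminus_tensor :: "'a \<otimes> 'b \<Rightarrow> 'a \<otimes> 'b" is uminus
  unfolding tensor_eq_def by (rule span_congs)
lift_definition scaleC_tensor :: "complex \<Rightarrow> 'a \<otimes> 'b \<Rightarrow> 'a \<otimes> 'b" is scaleC
  unfolding tensor_eq_def by (rule span_congs)
instance
  by (standard; transfer)
    (simp_all add: tensor_eq_def complex_vector.span_zero scaleC_add_right scaleC_add_left
      scaleC_scaleC scaleC_one algebra_simps)
end

lift_definition tensor_elem :: "'a::complex_vector \<Rightarrow> 'b::complex_vector \<Rightarrow> 'a \<otimes> 'b"
    (infixr \<open>\<otimes>\<^sub>v\<close> 75)
  is "\<lambda>x y. Poly_Mapping.single (x, y) 1" .

text \<open>The linear map on the tensor product induced by \<open>B\<close>. It is independent of the chosen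
  representative when \<open>B\<close> is bilinear, and only used in that case.\<close>

definition tensor_lift ::
    "('a::complex_vector \<Rightarrow> 'b::complex_vector \<Rightarrow> 'c::complex_vector) \<Rightarrow> 'a \<otimes> 'b \<Rightarrow> 'c"
  where "tensor_lift B t = free_lift (\<lambda>(x, y). B x y) (rep_tensor t)"

lemma free_lift_bilinear_relations:
  assumes "cbilinear B" "p \<in> complex_vector.span bilinear_relations"
  shows "free_lift (\<lambda>(x, y). B x y) p = 0"
proof -
  interpret L: Vector_Spaces.linear scaleC scaleC "free_lift (\<lambda>(x, y). B x y)"
    by (rule clinear_free_lift)
  have "free_lift (\<lambda>(x, y). B x y) r = 0" if "r \<in> bilinear_relations" for r
    using that assms(1) unfolding bilinear_relations_def cbilinear_def
    by (auto simp: L.diff free_lift_single clinear_add[of "B _"] clinear_scaleC[of "B _"]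
        clinear_add[of "\<lambda>x. B x _"] clinear_scaleC[of "\<lambda>x. B x _"] scaleC_one)
  then show ?thesis
    using assms(2) L.eq_0_on_span by blast
qed

lemma tensor_lift_abs:
  assumes "cbilinear B"
  shows "tensor_lift B (abs_tensor p) = free_lift (\<lambda>(x, y). B x y) p"
proof -
  have "tensor_eq (rep_tensor (abs_tensor p)) p"
    using Quotient3_rep_abs[OF Quotient3_tensor] by (simp add: tensor.abs_eq_iff[symmetric]
        Quotient3_abs_rep[OF Quotient3_tensor])
  from free_lift_bilinear_relations[OF assms this[unfolded tensor_eq_def]] show ?thesis
    by (simp add: tensor_lift_def clinear_diff[OF clinear_free_lift])
qed

lemma clinear_tensor_lift:
  assumes "cbilinear B"
  shows "clinear (tensor_lift B)"
proof (rule clinearI)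
  fix s t :: "'a \<otimes> 'b" and c
  obtain p q where "s = abs_tensor p" "t = abs_tensor q"
    by (metis Quotient3_abs_rep[OF Quotient3_tensor])
  then show "tensor_lift B (s + t) = tensor_lift B s + tensor_lift B t"
    and "tensor_lift B (c *\<^sub>C s) = c *\<^sub>C tensor_lift B s"
    by (simp_all add: plus_tensor.abs_eq scaleC_tensor.abs_eq tensor_lift_abs[OF assms]
        clinear_add[OF clinear_free_lift] clinear_scaleC[OF clinear_free_lift])
qed

lemma tensor_lift_elem: "cbilinear B \<Longrightarrow> tensor_lift B (x \<otimes>\<^sub>v y) = B x y"
  by (simp add: tensor_elem.abs_eq tensor_lift_abs free_lift_single scaleC_one)

lemma single_scaleC: "Poly_Mapping.single k c = c *\<^sub>C Poly_Mapping.single k 1"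
  by (auto intro!: poly_mapping_eqI simp: lookup_scaleC lookup_single scaleC_complex_def when_def)

lemma bilinear_relationsI:
  "Poly_Mapping.single (x + x', y) 1 - Poly_Mapping.single (x, y) 1
     - Poly_Mapping.single (x', y) 1 \<in> bilinear_relations"
  "Poly_Mapping.single (x, y + y') 1 - Poly_Mapping.single (x, y) 1
     - Poly_Mapping.single (x, y') 1 \<in> bilinear_relations"
  "Poly_Mapping.single (c *\<^sub>C x, y) 1 - c *\<^sub>C Poly_Mapping.single (x, y) 1 \<in> bilinear_relations"
  "Poly_Mapping.single (x, c *\<^sub>C y) 1 - c *\<^sub>C Poly_Mapping.single (x, y) 1 \<in> bilinear_relations"
  unfolding bilinear_relations_def single_scaleC[symmetric] by blast+

lemma tensor_elem_add_left: "(x + x') \<otimes>\<^sub>v y = x \<otimes>\<^sub>v y + x' \<otimes>\<^sub>v y"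
  and tensor_elem_add_right: "x \<otimes>\<^sub>v (y + y') = x \<otimes>\<^sub>v y + x \<otimes>\<^sub>v y'"
  and tensor_elem_scaleC_left: "(c *\<^sub>C x) \<otimes>\<^sub>v y = c *\<^sub>C (x \<otimes>\<^sub>v y)"
  and tensor_elem_scaleC_right: "x \<otimes>\<^sub>v (c *\<^sub>C y) = c *\<^sub>C (x \<otimes>\<^sub>v y)"
  by (transfer, unfold tensor_eq_def diff_diff_eq[symmetric],
      rule complex_vector.span_base, rule bilinear_relationsI)+

lemma cbilinear_tensor_elem: "cbilinear tensor_elem"
  unfolding cbilinear_def
  by (auto intro!: clinearI simp: tensor_elem_add_left tensor_elem_add_right
      tensor_elem_scaleC_left tensor_elem_scaleC_right)

definition tensor_map ::
    "('a::complex_vector \<Rightarrow> 'c::complex_vector) \<Rightarrow> ('b::complex_vector \<Rightarrow> 'd::complex_vector)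
     \<Rightarrow> 'a \<otimes> 'b \<Rightarrow> 'c \<otimes> 'd"  (infixr \<open>\<otimes>\<^sub>m\<close> 75)
  where "f \<otimes>\<^sub>m g = tensor_lift (\<lambda>x y. f x \<otimes>\<^sub>v g y)"

definition assoc_right :: "('a::complex_vector \<otimes> 'b::complex_vector) \<otimes> 'c::complex_vector \<Rightarrow> 'a \<otimes> 'b \<otimes> 'c"
  where "assoc_right = tensor_lift (\<lambda>s z. tensor_lift (\<lambda>x y. x \<otimes>\<^sub>v y \<otimes>\<^sub>v z) s)"

definition assoc_left :: "'a::complex_vector \<otimes> 'b::complex_vector \<otimes> 'c::complex_vector \<Rightarrow> ('a \<otimes> 'b) \<otimes> 'c"
  where "assoc_left = tensor_lift (\<lambda>x. tensor_lift (\<lambda>y z. (x \<otimes>\<^sub>v y) \<otimes>\<^sub>v z))"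

definition unit_left :: "complex \<otimes> 'a::complex_vector \<Rightarrow> 'a"
  where "unit_left = tensor_lift (\<lambda>c x. c *\<^sub>C x)"

definition unit_right :: "'a::complex_vector \<otimes> complex \<Rightarrow> 'a"
  where "unit_right = tensor_lift (\<lambda>x c. c *\<^sub>C x)"

text \<open>Triple tensor products are bracketed to the right.\<close>

definition leg12 :: "('a::complex_vector \<otimes> 'a \<Rightarrow> 'a \<otimes> 'a) \<Rightarrow> 'a \<otimes> 'a \<otimes> 'a \<Rightarrow> 'a \<otimes> 'a \<otimes> 'a"
  where "leg12 \<Psi> = assoc_right \<circ> (\<Psi> \<otimes>\<^sub>m id) \<circ> assoc_left"

definition leg23 :: "('a::complex_vector \<otimes> 'a \<Rightarrow> 'a \<otimes> 'a) \<Rightarrow> 'a \<otimes> 'a \<otimes> 'a \<Rightarrow> 'a \<otimes> 'a \<otimes> 'a"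
  where "leg23 \<Psi> = id \<otimes>\<^sub>m \<Psi>"

text \<open>\<open>id \<otimes> \<Psi> \<otimes> id\<close> on a fourfold tensor product bracketed in pairs.\<close>

definition middle ::
    "('a::complex_vector \<otimes> 'a \<Rightarrow> 'a \<otimes> 'a) \<Rightarrow> ('a \<otimes> 'a) \<otimes> ('a \<otimes> 'a) \<Rightarrow> ('a \<otimes> 'a) \<otimes> ('a \<otimes> 'a)"
  where "middle \<Psi> = assoc_left \<circ> (id \<otimes>\<^sub>m leg12 \<Psi>) \<circ> assoc_right"

lemma poly_mapping_eq_free_lift: "free_lift (\<lambda>k. Poly_Mapping.single k 1) p = p"
proof -
  have "free_lift (\<lambda>k. Poly_Mapping.single k 1) p
      = (\<Sum>k\<in>Poly_Mapping.keys p. Poly_Mapping.single k (Poly_Mapping.lookup p k))"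
    unfolding free_lift_def by (rule sum.cong) (metis single_scaleC)+
  also have "\<dots> = p"
    by (auto intro!: poly_mapping_eqI simp: lookup_sum lookup_single when_def in_keys_iff)
  finally show ?thesis .
qed

lemma clinear_free_lift_eq:
  assumes "clinear h"
  shows "h (free_lift f p) = free_lift (\<lambda>k. h (f k)) p"
proof -
  interpret h: Vector_Spaces.linear scaleC scaleC h by fact
  show ?thesis by (simp add: free_lift_def h.sum h.scale)
qed

lemma tensor_induct [case_names elem add]:
  assumes elem: "\<And>x y. P (x \<otimes>\<^sub>v y)" and add: "\<And>s t. P s \<Longrightarrow> P t \<Longrightarrow> P (s + t)"
  shows "P t"
proof -
  have abs: "clinear (abs_tensor :: ('a \<times> 'b \<Rightarrow>\<^sub>0 complex) \<Rightarrow> 'a \<otimes> 'b)"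
    by (rule clinearI) (simp_all add: plus_tensor.abs_eq scaleC_tensor.abs_eq)
  have P_sum: "P (\<Sum>k\<in>K. c k *\<^sub>C abs_tensor (Poly_Mapping.single k 1))" if "finite K" for K c
    using that
  proof induction
    case empty
    have "(0 :: 'a) \<otimes>\<^sub>v (0 :: 'b) = 0"
      using tensor_elem_scaleC_left[of 0 "0 :: 'a" "0 :: 'b"] by simp
    then show ?case using elem[of 0 0] by simp
  next
    case (insert k K)
    obtain x y where "k = (x, y)" by (cases k)
    then have "c k *\<^sub>C abs_tensor (Poly_Mapping.single k 1) = (c k *\<^sub>C x) \<otimes>\<^sub>v y"
      by (simp add: tensor_elem.abs_eq[symmetric] tensor_elem_scaleC_left)
    then show ?case using insert elem add by simp
  qed
  have "abs_tensor (rep_tensor t) = free_lift (\<lambda>k. abs_tensor (Poly_Mapping.single k 1)) (rep_tensor t)"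
    using clinear_free_lift_eq[OF abs, of "\<lambda>k. Poly_Mapping.single k 1" "rep_tensor t"]
    by (simp add: poly_mapping_eq_free_lift)
  then have "t = free_lift (\<lambda>k. abs_tensor (Poly_Mapping.single k 1)) (rep_tensor t)"
    by (simp add: Quotient3_abs_rep[OF Quotient3_tensor])
  then show ?thesis
    using P_sum[of "Poly_Mapping.keys (rep_tensor t)" "Poly_Mapping.lookup (rep_tensor t)"]
    by (simp add: free_lift_def)
qed

lemma cbilinear_tensor_map:
  "clinear f \<Longrightarrow> clinear g \<Longrightarrow> cbilinear (\<lambda>x y. f x \<otimes>\<^sub>v g y)"
  unfolding cbilinear_def
  by (auto intro!: clinearI simp: clinear_add clinear_scaleC tensor_elem_add_left
      tensor_elem_add_right tensor_elem_scaleC_left tensor_elem_scaleC_right)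

lemma clinear_tensor_map: "clinear f \<Longrightarrow> clinear g \<Longrightarrow> clinear (f \<otimes>\<^sub>m g)"
  and tensor_map_elem: "clinear f \<Longrightarrow> clinear g \<Longrightarrow> (f \<otimes>\<^sub>m g) (x \<otimes>\<^sub>v y) = f x \<otimes>\<^sub>v g y"
  by (simp_all add: tensor_map_def clinear_tensor_lift tensor_lift_elem cbilinear_tensor_map)

lemma cbilinear_tensor_lift:
  assumes "\<And>z. cbilinear (\<lambda>x y. B x y z)" "\<And>x y. clinear (B x y)"
  shows "cbilinear (\<lambda>s z. tensor_lift (\<lambda>x y. B x y z) s)"
  unfolding cbilinear_def
proof (intro conjI allI)
  show "clinear (tensor_lift (\<lambda>x y. B x y z))" for z
    by (rule clinear_tensor_lift[OF assms(1)])
  fix s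
  show "clinear (\<lambda>z. tensor_lift (\<lambda>x y. B x y z) s)"
  proof (induction s rule: tensor_induct)
    case (elem x y)
    then show ?case using assms(2)[of x y] by (simp add: tensor_lift_elem[OF assms(1)])
  next
    case (add s t)
    then show ?case
      by (intro clinearI)
        (simp_all add: clinear_add[OF clinear_tensor_lift[OF assms(1)]] scaleC_add_right
          clinear_add[OF add(1)] clinear_add[OF add(2)] clinear_scaleC[OF add(1)]
          clinear_scaleC[OF add(2)])
  qed
qed

lemma cbilinear_swap: "cbilinear B \<Longrightarrow> cbilinear (\<lambda>y x. B x y)"
  by (auto simp: cbilinear_def)

lemmas tensor_elem_linear_simps =
  tensor_elem_add_left tensor_elem_add_right tensor_elem_scaleC_left tensor_elem_scaleC_right

lemma assoc_right:
  fixes x :: "'a::complex_vector" and y :: "'b::complex_vector" and z :: "'c::complex_vector"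
  shows "clinear (assoc_right :: ('a \<otimes> 'b) \<otimes> 'c \<Rightarrow> _)"
    and "assoc_right ((x \<otimes>\<^sub>v y) \<otimes>\<^sub>v z) = x \<otimes>\<^sub>v y \<otimes>\<^sub>v z"
proof -
  have 1: "cbilinear (\<lambda>(x::'a) (y::'b). x \<otimes>\<^sub>v y \<otimes>\<^sub>v z)" for z :: 'c
    by (auto simp: cbilinear_def tensor_elem_linear_simps intro!: clinearI)
  have 2: "cbilinear (\<lambda>s (z::'c). tensor_lift (\<lambda>(x::'a) (y::'b). x \<otimes>\<^sub>v y \<otimes>\<^sub>v z) s)"
    by (rule cbilinear_tensor_lift[OF 1]) (auto simp: tensor_elem_linear_simps intro!: clinearI)
  show "clinear (assoc_right :: ('a \<otimes> 'b) \<otimes> 'c \<Rightarrow> _)"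
    "assoc_right ((x \<otimes>\<^sub>v y) \<otimes>\<^sub>v z) = x \<otimes>\<^sub>v y \<otimes>\<^sub>v z"
    unfolding assoc_right_def using clinear_tensor_lift[OF 2]
    by (simp_all add: tensor_lift_elem[OF 2] tensor_lift_elem[OF 1])
qed

lemma assoc_left:
  fixes x :: "'a::complex_vector" and y :: "'b::complex_vector" and z :: "'c::complex_vector"
  shows "clinear (assoc_left :: 'a \<otimes> 'b \<otimes> 'c \<Rightarrow> _)"
    and "assoc_left (x \<otimes>\<^sub>v y \<otimes>\<^sub>v z) = (x \<otimes>\<^sub>v y) \<otimes>\<^sub>v z"
proof -
  have 1: "cbilinear (\<lambda>(y::'b) (z::'c). (x \<otimes>\<^sub>v y) \<otimes>\<^sub>v z)" for x :: 'a
    by (auto simp: cbilinear_def tensor_elem_linear_simps intro!: clinearI)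
  have 2: "cbilinear (\<lambda>(x::'a). tensor_lift (\<lambda>(y::'b) (z::'c). (x \<otimes>\<^sub>v y) \<otimes>\<^sub>v z))"
    by (rule cbilinear_swap, rule cbilinear_tensor_lift[OF 1])
      (auto simp: tensor_elem_linear_simps intro!: clinearI)
  show "clinear (assoc_left :: 'a \<otimes> 'b \<otimes> 'c \<Rightarrow> _)"
    "assoc_left (x \<otimes>\<^sub>v y \<otimes>\<^sub>v z) = (x \<otimes>\<^sub>v y) \<otimes>\<^sub>v z"
    unfolding assoc_left_def using clinear_tensor_lift[OF 2]
    by (simp_all add: tensor_lift_elem[OF 2] tensor_lift_elem[OF 1])
qed

lemma cbilinear_scaleC: "cbilinear (scaleC :: complex \<Rightarrow> 'a \<Rightarrow> 'a::complex_vector)"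
  by (auto simp: cbilinear_def scaleC_add_left scaleC_add_right scaleC_scaleC scaleC_complex_def
      mult.commute intro!: clinearI)

lemma clinear_unit_left: "clinear unit_left"
  and unit_left_elem: "unit_left (c \<otimes>\<^sub>v x) = c *\<^sub>C x"
  by (simp_all add: unit_left_def clinear_tensor_lift tensor_lift_elem cbilinear_scaleC)

lemma clinear_unit_right: "clinear unit_right"
  and unit_right_elem: "unit_right (x \<otimes>\<^sub>v c) = c *\<^sub>C x"
  by (simp_all add: unit_right_def clinear_tensor_lift tensor_lift_elem
      cbilinear_swap[OF cbilinear_scaleC])


section \<open>Braided Lie algebras\<close>

locale coalgebra =
  fixes \<Delta> :: "'a::complex_vector \<Rightarrow> 'a \<otimes> 'a"
    and \<epsilon> :: "'a \<Rightarrow> complex"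
  assumes linear_comult: "clinear \<Delta>"
    and linear_counit: "clinear \<epsilon>"
    and coassoc: "assoc_right \<circ> (\<Delta> \<otimes>\<^sub>m id) \<circ> \<Delta> = (id \<otimes>\<^sub>m \<Delta>) \<circ> \<Delta>"
    and counit_left: "unit_left \<circ> (\<epsilon> \<otimes>\<^sub>m id) \<circ> \<Delta> = id"
    and counit_right: "unit_right \<circ> (id \<otimes>\<^sub>m \<epsilon>) \<circ> \<Delta> = id"

locale braiding =
  fixes \<Psi> :: "'a::complex_vector \<otimes> 'a \<Rightarrow> 'a \<otimes> 'a"
  assumes linear_braiding: "clinear \<Psi>"
    and braid_relation: "leg23 \<Psi> \<circ> leg12 \<Psi> \<circ> leg23 \<Psi> = leg12 \<Psi> \<circ> leg23 \<Psi> \<circ> leg12 \<Psi>"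

locale compatible_braiding = coalgebra \<Delta> \<epsilon> + braiding \<Psi>\<^sub>0
  for \<Delta> :: "'a::complex_vector \<Rightarrow> 'a \<otimes> 'a"
    and \<epsilon> :: "'a \<Rightarrow> complex"
    and \<Psi>\<^sub>0 :: "'a \<otimes> 'a \<Rightarrow> 'a \<otimes> 'a" +
  assumes comult_right:
      "(id \<otimes>\<^sub>m \<Delta>) \<circ> \<Psi>\<^sub>0 = leg12 \<Psi>\<^sub>0 \<circ> leg23 \<Psi>\<^sub>0 \<circ> assoc_right \<circ> (\<Delta> \<otimes>\<^sub>m id)"
    and comult_left:
      "assoc_right \<circ> (\<Delta> \<otimes>\<^sub>m id) \<circ> \<Psi>\<^sub>0 = leg23 \<Psi>\<^sub>0 \<circ> leg12 \<Psi>\<^sub>0 \<circ> (id \<otimes>\<^sub>m \<Delta>)"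
    and counit_braiding_right: "unit_right \<circ> (id \<otimes>\<^sub>m \<epsilon>) \<circ> \<Psi>\<^sub>0 = unit_left \<circ> (\<epsilon> \<otimes>\<^sub>m id)"
    and counit_braiding_left: "unit_left \<circ> (\<epsilon> \<otimes>\<^sub>m id) \<circ> \<Psi>\<^sub>0 = unit_right \<circ> (id \<otimes>\<^sub>m \<epsilon>)"

locale braided_lie_algebra = compatible_braiding \<Delta> \<epsilon> \<Psi>\<^sub>0
  for \<Delta> :: "'a::complex_vector \<Rightarrow> 'a \<otimes> 'a"
    and \<epsilon> :: "'a \<Rightarrow> complex"
    and \<Psi>\<^sub>0 :: "'a \<otimes> 'a \<Rightarrow> 'a \<otimes> 'a" +
  fixes br :: "'a \<otimes> 'a \<Rightarrow> 'a"
  assumes linear_bracket: "clinear br"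
    and bracket_left:
      "\<Psi>\<^sub>0 \<circ> (br \<otimes>\<^sub>m id) \<circ> assoc_left = (id \<otimes>\<^sub>m br) \<circ> leg12 \<Psi>\<^sub>0 \<circ> leg23 \<Psi>\<^sub>0"
    and bracket_right:
      "\<Psi>\<^sub>0 \<circ> (id \<otimes>\<^sub>m br) = (br \<otimes>\<^sub>m id) \<circ> assoc_left \<circ> leg23 \<Psi>\<^sub>0 \<circ> leg12 \<Psi>\<^sub>0"
    and L1_jacobi: "br \<circ> (id \<otimes>\<^sub>m br) = br \<circ> (br \<otimes>\<^sub>m br) \<circ> middle \<Psi>\<^sub>0 \<circ> (\<Delta> \<otimes>\<^sub>m id)"
    and L2_cocommutative:
      "\<Psi>\<^sub>0 \<circ> (br \<otimes>\<^sub>m id) \<circ> assoc_left \<circ> (id \<otimes>\<^sub>m \<Psi>\<^sub>0) \<circ> assoc_right \<circ> (\<Delta> \<otimes>\<^sub>m id)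
        = (id \<otimes>\<^sub>m br) \<circ> assoc_right \<circ> (\<Delta> \<otimes>\<^sub>m id)"
    and L3_comult: "\<Delta> \<circ> br = (br \<otimes>\<^sub>m br) \<circ> middle \<Psi>\<^sub>0 \<circ> (\<Delta> \<otimes>\<^sub>m \<Delta>)"
    and L3_counit: "\<epsilon> \<circ> br = unit_left \<circ> (\<epsilon> \<otimes>\<^sub>m \<epsilon>)"

definition bracket_braiding ::
    "('a::complex_vector \<Rightarrow> 'a \<otimes> 'a) \<Rightarrow> ('a \<otimes> 'a \<Rightarrow> 'a \<otimes> 'a) \<Rightarrow> ('a \<otimes> 'a \<Rightarrow> 'a) \<Rightarrow> 'a \<otimes> 'a \<Rightarrow> 'a \<otimes> 'a"
  where "bracket_braiding \<Delta> \<Psi>\<^sub>0 br =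
    (br \<otimes>\<^sub>m id) \<circ> assoc_left \<circ> (id \<otimes>\<^sub>m \<Psi>\<^sub>0) \<circ> assoc_right \<circ> (\<Delta> \<otimes>\<^sub>m id)"


section \<open>The tensor algebra\<close>

text \<open>The free monoid, as a type of its own so that convolution on \<open>'a word \<Rightarrow>\<^sub>0 complex\<close> is
  the product of the free algebra.\<close>

datatype 'a word = Word (letters: "'a list")

instantiation word :: (type) monoid_add
begin
definition zero_word :: "'a word" where "zero_word = Word []"
definition plus_word :: "'a word \<Rightarrow> 'a word \<Rightarrow> 'a word"
  where "plus_word v w = Word (letters v @ letters w)"
instance by standard (simp_all add: zero_word_def plus_word_def)
end

text \<open>The tensor algebra of a vector space is the free unital algebra on its underlying set modulo
  the two-sided ideal that makes the inclusion of the generators linear.\<close>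

definition letter :: "'a \<Rightarrow> 'a word \<Rightarrow>\<^sub>0 complex"
  where "letter x = Poly_Mapping.single (Word [x]) 1"

definition linearity_relations :: "('a::complex_vector word \<Rightarrow>\<^sub>0 complex) set"
  where "linearity_relations =
    {letter (x + y) - letter x - letter y | x y. True} \<union>
    {letter (c *\<^sub>C x) - c *\<^sub>C letter x | c x. True}"

definition linearity_ideal_gens :: "('a::complex_vector word \<Rightarrow>\<^sub>0 complex) set"
  where "linearity_ideal_gens = {a * r * b | a r b. r \<in> linearity_relations}"

definition talg_eq ::
    "('a::complex_vector word \<Rightarrow>\<^sub>0 complex) \<Rightarrow> ('a word \<Rightarrow>\<^sub>0 complex) \<Rightarrow> bool"
  where "talg_eq p q \<longleftrightarrow> p - q \<in> complex_vector.span linearity_ideal_gens"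

quotient_type (overloaded) 'a tensor_algebra =
    "'a::complex_vector word \<Rightarrow>\<^sub>0 complex" / talg_eq
  unfolding talg_eq_def by (rule span_eq_equivp)

lemma scaleC_conv_mult:
  fixes p :: "'k::monoid_add \<Rightarrow>\<^sub>0 complex"
  shows "c *\<^sub>C p = Poly_Mapping.single 0 c * p"
  unfolding mult_map_scale_conv_mult[symmetric] scaleC_poly_mapping_def scaleC_complex_def ..

lemma scaleC_conv_mult_right:
  fixes p :: "'k::monoid_add \<Rightarrow>\<^sub>0 complex"
  shows "c *\<^sub>C p = p * Poly_Mapping.single 0 c"
proof -
  have p: "(\<Sum>k\<in>Poly_Mapping.keys p. Poly_Mapping.single k (Poly_Mapping.lookup p k)) = p"
    by (auto intro!: poly_mapping_eqI simp: lookup_sum lookup_single when_def in_keys_iff)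
  have "Poly_Mapping.single 0 c * p = p * Poly_Mapping.single 0 c"
    by (subst (1 2) p[symmetric])
      (simp add: sum_distrib_left sum_distrib_right mult_single mult.commute)
  then show ?thesis by (simp add: scaleC_conv_mult)
qed

lemma poly_mapping_mult_scaleC:
  fixes p q :: "'k::monoid_add \<Rightarrow>\<^sub>0 complex"
  shows "(c *\<^sub>C p) * q = c *\<^sub>C (p * q)" "p * (c *\<^sub>C q) = c *\<^sub>C (p * q)"
  by (simp add: scaleC_conv_mult mult.assoc) (simp add: scaleC_conv_mult_right mult.assoc)

lemma linearity_ideal:
  assumes "p \<in> complex_vector.span linearity_ideal_gens"
  shows "a * p * b \<in> complex_vector.span linearity_ideal_gens"
  using assms
proof (induction rule: complex_vector.span_induct_alt)
  case base
  show ?case by (simp add: complex_vector.span_zero)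
next
  case (step c x y)
  obtain a' r b' where x: "x = a' * r * b'" "r \<in> linearity_relations"
    using step(1) by (auto simp: linearity_ideal_gens_def)
  then have "a * x * b = (a * a') * r * (b' * b)" by (simp add: mult.assoc)
  with x(2) have "a * x * b \<in> linearity_ideal_gens"
    unfolding linearity_ideal_gens_def by blast
  then have "c *\<^sub>C (a * x * b) + a * y * b \<in> complex_vector.span linearity_ideal_gens"
    by (intro complex_vector.span_add complex_vector.span_scale complex_vector.span_base step)
  then show ?case
    by (simp add: distrib_left distrib_right poly_mapping_mult_scaleC)
qed

lemma linearity_ideal_mult_cong:
  assumes "p - p' \<in> complex_vector.span linearity_ideal_gens"
    "q - q' \<in> complex_vector.span linearity_ideal_gens"
  shows "p * q - p' * q' \<in> complex_vector.span linearity_ideal_gens"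
proof -
  have "p * q - p' * q' = 1 * (p - p') * q + p' * (q - q') * 1"
    by (simp add: algebra_simps)
  then show ?thesis
    using assms by (simp only:) (intro complex_vector.span_add linearity_ideal)
qed

instantiation tensor_algebra :: (complex_vector) complex_algebra_1
begin
lift_definition zero_tensor_algebra :: "'a tensor_algebra" is 0 .
lift_definition one_tensor_algebra :: "'a tensor_algebra" is 1 .
lift_definition plus_tensor_algebra :: "'a tensor_algebra \<Rightarrow> 'a tensor_algebra \<Rightarrow> 'a tensor_algebra"
  is "(+)" unfolding talg_eq_def by (rule span_congs)
lift_definition minus_tensor_algebra :: "'a tensor_algebra \<Rightarrow> 'a tensor_algebra \<Rightarrow> 'a tensor_algebra"
  is "(-)" unfolding talg_eq_def by (rule span_congs)
lift_definition uminus_tensor_algebra :: "'a tensor_algebra \<Rightarrow> 'a tensor_algebra"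
  is uminus unfolding talg_eq_def by (rule span_congs)
lift_definition times_tensor_algebra :: "'a tensor_algebra \<Rightarrow> 'a tensor_algebra \<Rightarrow> 'a tensor_algebra"
  is "(*)" unfolding talg_eq_def by (rule linearity_ideal_mult_cong)
lift_definition scaleC_tensor_algebra :: "complex \<Rightarrow> 'a tensor_algebra \<Rightarrow> 'a tensor_algebra"
  is scaleC unfolding talg_eq_def by (rule span_congs)
instance
  by (standard; transfer)
    (simp_all add: talg_eq_def complex_vector.span_zero scaleC_add_right scaleC_add_left
      scaleC_scaleC scaleC_one algebra_simps poly_mapping_mult_scaleC)
end

lift_definition talg_gen :: "'a::complex_vector \<Rightarrow> 'a tensor_algebra" is letter .

lemma clinear_talg_gen: "clinear talg_gen"
proof (rule clinearI; transfer)
  fix x y :: 'a and c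
  have gens: "r \<in> complex_vector.span linearity_ideal_gens"
    if "r \<in> linearity_relations" for r :: "'a word \<Rightarrow>\<^sub>0 complex"
  proof (rule complex_vector.span_base)
    have "r = 1 * r * 1" by simp
    then show "r \<in> linearity_ideal_gens" using that unfolding linearity_ideal_gens_def by blast
  qed
  show "talg_eq (letter (x + y)) (letter x + letter y)"
    unfolding talg_eq_def diff_diff_eq[symmetric]
    by (rule gens) (auto simp: linearity_relations_def)
  show "talg_eq (letter (c *\<^sub>C x)) (c *\<^sub>C letter x)"
    unfolding talg_eq_def by (rule gens) (auto simp: linearity_relations_def)
qed

text \<open>The product restricted to pairs of generators, as a map from the tensor square.\<close>

definition talg_product :: "'a::complex_vector \<otimes> 'a \<Rightarrow> 'a tensor_algebra"
  where "talg_product = tensor_lift (\<lambda>x y. talg_gen x * talg_gen y)"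

lemma cbilinear_talg_gen_mult: "cbilinear (\<lambda>x y. talg_gen x * talg_gen y)"
  unfolding cbilinear_def
  by (auto intro!: clinearI simp: clinear_add[OF clinear_talg_gen]
      clinear_scaleC[OF clinear_talg_gen] distrib_left distrib_right
      mult_scaleC_left mult_scaleC_right)

lemma clinear_talg_product: "clinear talg_product"
  and talg_product_elem: "talg_product (x \<otimes>\<^sub>v y) = talg_gen x * talg_gen y"
  unfolding talg_product_def
  by (simp_all add: clinear_tensor_lift tensor_lift_elem cbilinear_talg_gen_mult)


section \<open>Algebras given by generators and relations\<close>

locale complex_algebra =
  Module.module "ring_of_type_algebra :: complex ring" A + Ring.ring A
  for A :: "(complex, 'b) module" (structure) +
  assumes smult_mult_left:
      "x \<in> carrier A \<Longrightarrow> y \<in> carrier A \<Longrightarrow> (c \<odot> x) \<otimes> y = c \<odot> (x \<otimes> y)"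
    and smult_mult_right:
      "x \<in> carrier A \<Longrightarrow> y \<in> carrier A \<Longrightarrow> x \<otimes> (c \<odot> y) = c \<odot> (x \<otimes> y)"

definition tensor_alg :: "(complex, 'a::complex_vector tensor_algebra) module"
  where "tensor_alg = \<lparr>carrier = UNIV, monoid.mult = (*), one = 1, ring.zero = 0, add = (+), module.smult = scaleC\<rparr>"

definition algebra_quotient ::
    "(complex, 'b) module \<Rightarrow> 'b set \<Rightarrow> (complex, 'b set) module"
  where "algebra_quotient A I =
    ring.extend (A Quot I) \<lparr>module.smult = (\<lambda>c K. \<Union>x\<in>K. I +>\<^bsub>A\<^esub> (c \<odot>\<^bsub>A\<^esub> x))\<rparr>"

definition algebra_hom ::
    "(complex, 'b) module \<Rightarrow> (complex, 'c) module \<Rightarrow> ('b \<Rightarrow> 'c) set"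
  where "algebra_hom A B =
    {h \<in> ring_hom A B. \<forall>c. \<forall>x\<in>carrier A. h (c \<odot>\<^bsub>A\<^esub> x) = c \<odot>\<^bsub>B\<^esub> h x}"

inductive_set generated_algebra :: "(complex, 'b) module \<Rightarrow> 'b set \<Rightarrow> 'b set"
  for A :: "(complex, 'b) module" (structure) and S :: "'b set" where
  gen: "x \<in> S \<Longrightarrow> x \<in> generated_algebra A S"
| add: "x \<in> generated_algebra A S \<Longrightarrow> y \<in> generated_algebra A S \<Longrightarrow> x \<oplus> y \<in> generated_algebra A S"
| mult: "x \<in> generated_algebra A S \<Longrightarrow> y \<in> generated_algebra A S \<Longrightarrow> x \<otimes> y \<in> generated_algebra A S"
| smult: "x \<in> generated_algebra A S \<Longrightarrow> c \<odot> x \<in> generated_algebra A S"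

text \<open>\<open>A\<close> is the unital associative algebra generated by \<open>1\<close> and the vector space mapped to it
  by \<open>i\<close>, with relations \<open>r = 0\<close> for \<open>r \<in> R\<close>: it is generated by these elements, and the
  relations that hold between them are exactly the consequences of \<open>R\<close>.\<close>

definition generated_with_relations ::
    "(complex, 'b) module \<Rightarrow> ('a::complex_vector \<Rightarrow> 'b) \<Rightarrow> 'a tensor_algebra set \<Rightarrow> bool"
  where "generated_with_relations A i R \<longleftrightarrow>
    complex_algebra A \<and>
    generated_algebra A (insert \<one>\<^bsub>A\<^esub> (range i)) = carrier A \<and>
    (\<exists>h \<in> algebra_hom tensor_alg A.
       (\<forall>x. h (talg_gen x) = i x) \<and> a_kernel tensor_alg A h = Idl\<^bsub>tensor_alg\<^esub> R)"

text \<open>The relations \<open>\<cdot> \<circ> \<Phi> = \<cdot>\<close> on the tensor square of the generators.\<close>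

definition product_relations :: "('a::complex_vector \<otimes> 'a \<Rightarrow> 'a \<otimes> 'a) \<Rightarrow> 'a tensor_algebra set"
  where "product_relations \<Phi> = {talg_product (\<Phi> t) - talg_product t | t. True}"

definition enveloping_ideal ::
    "('a::complex_vector \<Rightarrow> 'a \<otimes> 'a) \<Rightarrow> ('a \<otimes> 'a \<Rightarrow> 'a \<otimes> 'a) \<Rightarrow> ('a \<otimes> 'a \<Rightarrow> 'a) \<Rightarrow> 'a tensor_algebra set"
  where "enveloping_ideal \<Delta> \<Psi>\<^sub>0 br = Idl\<^bsub>tensor_alg\<^esub>
    (product_relations
      ((br \<otimes>\<^sub>m id) \<circ> assoc_left \<circ> (id \<otimes>\<^sub>m \<Psi>\<^sub>0) \<circ> assoc_right \<circ> (\<Delta> \<otimes>\<^sub>m id)))"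

definition braided_enveloping_algebra ::
    "('a::complex_vector \<Rightarrow> 'a \<otimes> 'a) \<Rightarrow> ('a \<otimes> 'a \<Rightarrow> 'a \<otimes> 'a) \<Rightarrow> ('a \<otimes> 'a \<Rightarrow> 'a)
     \<Rightarrow> (complex, 'a tensor_algebra set) module"
  where "braided_enveloping_algebra \<Delta> \<Psi>\<^sub>0 br =
    algebra_quotient tensor_alg (enveloping_ideal \<Delta> \<Psi>\<^sub>0 br)"

definition enveloping_gen ::
    "('a::complex_vector \<Rightarrow> 'a \<otimes> 'a) \<Rightarrow> ('a \<otimes> 'a \<Rightarrow> 'a \<otimes> 'a) \<Rightarrow> ('a \<otimes> 'a \<Rightarrow> 'a)
     \<Rightarrow> 'a \<Rightarrow> 'a tensor_algebra set"
  where "enveloping_gen \<Delta> \<Psi>\<^sub>0 br x = enveloping_ideal \<Delta> \<Psi>\<^sub>0 br +>\<^bsub>tensor_alg\<^esub> talg_gen x"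

end

theory Submission
  imports Defs
begin

text \<open>
  If \<open>\<Psi>\<^sub>0\<close> is the flip and \<open>\<Delta> x = x\<^sub>1 \<otimes> x\<^sub>2\<close>, then \<open>\<Psi> (x \<otimes> y) = [x\<^sub>1, y] \<otimes> x\<^sub>2\<close>, and the two sides of
  the braid relation at \<open>x \<otimes> y \<otimes> z\<close> are
  \<open>[x\<^sub>1, [y\<^sub>1, z]] \<otimes> [x\<^sub>2, y\<^sub>2] \<otimes> x\<^sub>3\<close> and, by (L3),
  \<open>[[x\<^sub>1, y\<^sub>1], [x\<^sub>3, z]] \<otimes> [x\<^sub>2, y\<^sub>2] \<otimes> x\<^sub>4\<close>. Cocommutativity (L2) exchanges \<open>x\<^sub>2\<close> and \<open>x\<^sub>3\<close>, after which
  the Jacobi identity (L1) applied to \<open>x\<^sub>1\<close>, \<open>y\<^sub>1\<close>, \<open>z\<close> identifies the two. In general the same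
  three steps are carried out on string diagrams. The relations of the enveloping algebra are by
  definition those of \<open>\<Psi>\<close>, so what remains is that the quotient of the tensor algebra by the ideal of
  the relations is presented by them.
\<close>


section \<open>String diagrams as words\<close>

text \<open>
  The structure maps act on the first strands of a right-nested tensor product, and
  \<open>tail_map\<close> moves a map one strand to the right. Leaving the type of the remaining strands
  polymorphic makes associativity invisible, so that string diagrams become words in these maps.
\<close>

definition comult_head ::
    "('a::complex_vector \<Rightarrow> 'a \<otimes> 'a) \<Rightarrow> 'a \<otimes> 'r::complex_vector \<Rightarrow> 'a \<otimes> 'a \<otimes> 'r"
  where "comult_head \<Delta> t = assoc_right ((\<Delta> \<otimes>\<^sub>m id) t)"

definition braiding_head ::
    "('a::complex_vector \<otimes> 'a \<Rightarrow> 'a \<otimes> 'a) \<Rightarrow> 'a \<otimes> 'a \<otimes> 'r::complex_vector \<Rightarrow> 'a \<otimes> 'a \<otimes> 'r"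
  where "braiding_head \<Psi> t = assoc_right ((\<Psi> \<otimes>\<^sub>m id) (assoc_left t))"

definition bracket_head ::
    "('a::complex_vector \<otimes> 'a \<Rightarrow> 'a) \<Rightarrow> 'a \<otimes> 'a \<otimes> 'r::complex_vector \<Rightarrow> 'a \<otimes> 'r"
  where "bracket_head br t = (br \<otimes>\<^sub>m id) (assoc_left t)"

definition tail_map :: "('r::complex_vector \<Rightarrow> 's::complex_vector) \<Rightarrow> 'a::complex_vector \<otimes> 'r \<Rightarrow> 'a \<otimes> 's"
  where "tail_map f = id \<otimes>\<^sub>m f"

lemma clinear_id_fun: "clinear id"
  using clinear_id by (simp add: id_def)

lemma clinear_tensor_elem: "clinear (\<lambda>x. x \<otimes>\<^sub>v r)" "clinear ((\<otimes>\<^sub>v) x)"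
  using cbilinear_tensor_elem by (auto simp: cbilinear_def)

lemma clinear_tail_map: "clinear f \<Longrightarrow> clinear (tail_map f)"
  unfolding tail_map_def by (rule clinear_tensor_map[OF clinear_id_fun])

lemma tail_map_elem: "clinear f \<Longrightarrow> tail_map f (x \<otimes>\<^sub>v r) = x \<otimes>\<^sub>v f r"
  unfolding tail_map_def by (subst tensor_map_elem[OF clinear_id_fun]) auto

lemma clinear_eqI:
  assumes "clinear f" "clinear g" "\<And>x y. f (x \<otimes>\<^sub>v y) = g (x \<otimes>\<^sub>v y)"
  shows "f t = g t"
  by (induction t rule: tensor_induct) (simp_all add: assms clinear_add)

lemma tail_map_comp:
  "clinear f \<Longrightarrow> clinear g \<Longrightarrow> tail_map f (tail_map g t) = tail_map (\<lambda>u. f (g u)) t"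
  by (rule clinear_eqI[where t = t])
    (simp_all add: clinear_tail_map clinear_compose[of f g]
      clinear_compose[of "tail_map f" "tail_map g"] tail_map_elem)

lemma tail_map_ident: "tail_map (\<lambda>x. x) t = t"
  by (rule clinear_eqI[where t = t]) (simp_all add: clinear_tail_map clinear_id tail_map_elem)

text \<open>The term \<open>tail_map (\<lambda>x. x \<otimes>\<^sub>v r) u\<close> is
  \<open>u \<otimes>\<^sub>v r\<close> rebracketed to the right. Here \<open>u\<close> stays an
  arbitrary tensor instead of a product of vectors, because the braiding and the bracket act on
  \<open>u\<close> as a whole.\<close>

lemma tensor2_induct [case_names elem add]:
  assumes "\<And>u r. P (tail_map (\<lambda>x. x \<otimes>\<^sub>v r) u)" "\<And>s t. P s \<Longrightarrow> P t \<Longrightarrow> P (s + t)"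
  shows "P (t :: 'a::complex_vector \<otimes> 'b::complex_vector \<otimes> 'r::complex_vector)"
proof (induction t rule: tensor_induct)
  case (elem x t)
  show ?case
  proof (induction t rule: tensor_induct)
    case (elem y r)
    show ?case using assms(1)[of r "x \<otimes>\<^sub>v y"] by (simp add: tail_map_elem clinear_tensor_elem)
  qed (simp add: tensor_elem_add_right assms(2))
qed (rule assms(2))

lemma clinear_eqI2:
  assumes "clinear f" "clinear g"
    "\<And>u r. f (tail_map (\<lambda>x. x \<otimes>\<^sub>v r) u) = g (tail_map (\<lambda>x. x \<otimes>\<^sub>v r) u)"
  shows "f (t :: 'a::complex_vector \<otimes> 'b::complex_vector \<otimes> 'r::complex_vector) = g t"
  by (induction t rule: tensor2_induct) (simp_all add: assms clinear_add)

lemma assoc_left_right: "assoc_left (assoc_right t) = t"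
proof (induction t rule: tensor_induct)
  case (elem s z)
  show ?case
    by (induction s rule: tensor_induct)
      (simp_all add: assoc_left assoc_right tensor_elem_add_left clinear_add[OF assoc_left(1)]
        clinear_add[OF assoc_right(1)])
qed (simp add: clinear_add[OF assoc_left(1)] clinear_add[OF assoc_right(1)])

lemma assoc_right_left: "assoc_right (assoc_left t) = t"
proof (induction t rule: tensor_induct)
  case (elem z s)
  show ?case
    by (induction s rule: tensor_induct)
      (simp_all add: assoc_left assoc_right tensor_elem_add_right clinear_add[OF assoc_left(1)]
        clinear_add[OF assoc_right(1)])
qed (simp add: clinear_add[OF assoc_left(1)] clinear_add[OF assoc_right(1)])

lemma assoc_left_tail_map_elem: "assoc_left (tail_map (\<lambda>x. x \<otimes>\<^sub>v r) u) = u \<otimes>\<^sub>v r"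
  by (induction u rule: tensor_induct)
    (simp_all add: assoc_left clinear_add[OF assoc_left(1)] tail_map_elem clinear_tensor_elem
      clinear_add[OF clinear_tail_map] tensor_elem_add_left)

lemma assoc_right_elem: "assoc_right (u \<otimes>\<^sub>v r) = tail_map (\<lambda>x. x \<otimes>\<^sub>v r) u"
  by (metis assoc_left_tail_map_elem assoc_right_left)

section \<open>Interchange of maps on disjoint strands\<close>

context
  fixes \<Delta> :: "'a::complex_vector \<Rightarrow> 'a \<otimes> 'a"
    and \<Psi> :: "'a \<otimes> 'a \<Rightarrow> 'a \<otimes> 'a"
    and br :: "'a \<otimes> 'a \<Rightarrow> 'a"
  assumes lin: "clinear \<Delta>" "clinear \<Psi>" "clinear br"
begin

lemma clinear_heads:
  "clinear (comult_head \<Delta>)" "clinear (braiding_head \<Psi>)" "clinear (bracket_head br)"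
  unfolding comult_head_def[abs_def] braiding_head_def[abs_def] bracket_head_def[abs_def]
  by (rule clinear_compose[OF assoc_right(1)] clinear_compose[OF clinear_tensor_map]
      clinear_tensor_map assoc_left(1) clinear_id_fun lin)+

lemma heads_elem:
  "comult_head \<Delta> (x \<otimes>\<^sub>v r) = tail_map (\<lambda>x. x \<otimes>\<^sub>v r) (\<Delta> x)"
  "braiding_head \<Psi> (tail_map (\<lambda>x. x \<otimes>\<^sub>v r) u) = tail_map (\<lambda>x. x \<otimes>\<^sub>v r) (\<Psi> u)"
  "bracket_head br (tail_map (\<lambda>x. x \<otimes>\<^sub>v r) u) = br u \<otimes>\<^sub>v r"
  by (simp_all add: comult_head_def braiding_head_def bracket_head_def assoc_left_tail_map_elem
      assoc_right_elem tensor_map_elem lin clinear_id_fun)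

text \<open>Maps on disjoint strands commute. The coproduct adds a strand and the bracket removes
  one, so the position of \<open>f\<close> shifts by one when it passes them and stays fixed when it
  passes the braiding.\<close>

lemma interchange_heads:
  assumes f: "clinear f"
  shows "comult_head \<Delta> (tail_map f s) = tail_map (tail_map f) (comult_head \<Delta> s)" (is ?D)
    and "braiding_head \<Psi> (tail_map (tail_map f) t)
          = tail_map (tail_map f) (braiding_head \<Psi> t)" (is ?P)
    and "bracket_head br (tail_map (tail_map f) t) = tail_map f (bracket_head br t)" (is ?B)
proof -
  note lins = clinear_heads clinear_tail_map f clinear_tensor_elem lin
  have *: "tail_map (tail_map f) (tail_map (\<lambda>x. x \<otimes>\<^sub>v r) u) = tail_map (\<lambda>x. x \<otimes>\<^sub>v f r) u"
    for r and u :: "'a \<otimes> 'a"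
    by (simp add: tail_map_comp lins tail_map_elem)
  show ?D
    by (rule clinear_eqI[where t = s])
      (simp_all add: clinear_compose[of "comult_head \<Delta>" "tail_map f"]
        clinear_compose[of "tail_map (tail_map f)" "comult_head \<Delta>"] lins heads_elem tail_map_elem *)
  show ?P
    by (rule clinear_eqI2[where t = t])
      (simp_all add: clinear_compose[of "braiding_head \<Psi>" "tail_map (tail_map f)"]
        clinear_compose[of "tail_map (tail_map f)" "braiding_head \<Psi>"] lins heads_elem *)
  show ?B
    by (rule clinear_eqI2[where t = t])
      (simp_all add: clinear_compose[of "bracket_head br" "tail_map (tail_map f)"]
        clinear_compose[of "tail_map f" "bracket_head br"] lins heads_elem tail_map_elem *)
qed

end

text \<open>This serves the axioms with three input strands, which are kept together in
  \<open>v\<close> while \<open>r\<close> holds everything further right.\<close>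

lemma tensor3_induct [case_names elem add]:
  assumes "\<And>v r. P (tail_map (tail_map (\<lambda>x. x \<otimes>\<^sub>v r)) v)" "\<And>s t. P s \<Longrightarrow> P t \<Longrightarrow> P (s + t)"
  shows "P (t :: 'a::complex_vector \<otimes> 'b::complex_vector \<otimes> 'c::complex_vector \<otimes> 'r::complex_vector)"
proof (induction t rule: tensor_induct)
  case (elem x t)
  show ?case
  proof (induction t rule: tensor2_induct)
    case (elem u r)
    show ?case using assms(1)[of r "x \<otimes>\<^sub>v u"]
      by (simp add: tail_map_elem clinear_tensor_elem clinear_tail_map)
  qed (simp add: tensor_elem_add_right assms(2))
qed (rule assms(2))

lemma clinear_eqI3:
  assumes "clinear f" "clinear g"
    "\<And>v r. f (tail_map (tail_map (\<lambda>x. x \<otimes>\<^sub>v r)) v) = g (tail_map (tail_map (\<lambda>x. x \<otimes>\<^sub>v r)) v)"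
  shows "f (t :: 'a::complex_vector \<otimes> 'b::complex_vector \<otimes> 'c::complex_vector \<otimes> 'r::complex_vector) = g t"
  by (induction t rule: tensor3_induct) (simp_all add: assms clinear_add)

lemma eq_assoc_left: "assoc_right s = t \<Longrightarrow> s = assoc_left t"
  by (metis assoc_left_right)


section \<open>The braid relation\<close>

context braided_lie_algebra
begin

text \<open>The index is the number of strands to the left of the map.\<close>

abbreviation D0 :: "'a \<otimes> 'r::complex_vector \<Rightarrow> 'a \<otimes> 'a \<otimes> 'r" where "D0 \<equiv> comult_head \<Delta>"
abbreviation D1 where "D1 \<equiv> tail_map D0"
abbreviation D2 where "D2 \<equiv> tail_map D1"
abbreviation D3 where "D3 \<equiv> tail_map D2"
abbreviation D4 where "D4 \<equiv> tail_map D3"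

abbreviation P0 :: "'a \<otimes> 'a \<otimes> 'r::complex_vector \<Rightarrow> 'a \<otimes> 'a \<otimes> 'r" where "P0 \<equiv> braiding_head \<Psi>\<^sub>0"
abbreviation P1 where "P1 \<equiv> tail_map P0"
abbreviation P2 where "P2 \<equiv> tail_map P1"
abbreviation P3 where "P3 \<equiv> tail_map P2"
abbreviation P4 where "P4 \<equiv> tail_map P3"
abbreviation P5 where "P5 \<equiv> tail_map P4"

abbreviation B0 :: "'a \<otimes> 'a \<otimes> 'r::complex_vector \<Rightarrow> 'a \<otimes> 'r" where "B0 \<equiv> bracket_head br"
abbreviation B1 where "B1 \<equiv> tail_map B0"
abbreviation B2 where "B2 \<equiv> tail_map B1"
abbreviation B3 where "B3 \<equiv> tail_map B2"
abbreviation B4 where "B4 \<equiv> tail_map B3"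

lemmas structure_maps_linear = linear_comult linear_braiding linear_bracket
lemmas heads_linear = clinear_heads[OF structure_maps_linear] clinear_tail_map clinear_tensor_elem
  structure_maps_linear
lemmas heads_append = heads_elem[OF structure_maps_linear]
lemmas interchange0 = interchange_heads[OF structure_maps_linear]

lemma heads_compose:
  "clinear f \<Longrightarrow> clinear (\<lambda>x. D0 (f x))"
  "clinear f' \<Longrightarrow> clinear (\<lambda>x. P0 (f' x))"
  "clinear f' \<Longrightarrow> clinear (\<lambda>x. B0 (f' x))"
  "clinear g \<Longrightarrow> clinear h \<Longrightarrow> clinear (\<lambda>x. tail_map g (h x))"
  by (rule clinear_compose[OF heads_linear(1)] clinear_compose[OF heads_linear(2)]
      clinear_compose[OF heads_linear(3)] clinear_compose[OF heads_linear(4)]; assumption)+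

lemma interchange1:
  assumes "clinear f"
  shows "D1 (tail_map (tail_map f) s) = tail_map (tail_map (tail_map f)) (D1 s)"
    and "P1 (tail_map (tail_map (tail_map f)) t) = tail_map (tail_map (tail_map f)) (P1 t)"
    and "B1 (tail_map (tail_map (tail_map f)) t) = tail_map (tail_map f) (B1 t)"
  by (simp_all add: tail_map_comp heads_linear heads_compose assms interchange0)

lemma interchange2:
  assumes "clinear f"
  shows "D2 (tail_map (tail_map (tail_map f)) s)
        = tail_map (tail_map (tail_map (tail_map f))) (D2 s)"
    and "P2 (tail_map (tail_map (tail_map (tail_map f))) t)
          = tail_map (tail_map (tail_map (tail_map f))) (P2 t)"
    and "B2 (tail_map (tail_map (tail_map (tail_map f))) t)
          = tail_map (tail_map (tail_map f)) (B2 t)"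
  by (simp_all add: tail_map_comp heads_linear heads_compose assms interchange0)

lemma interchange3:
  assumes "clinear f"
  shows "D3 (tail_map (tail_map (tail_map (tail_map f))) s)
        = tail_map (tail_map (tail_map (tail_map (tail_map f)))) (D3 s)"
    and "P3 (tail_map (tail_map (tail_map (tail_map (tail_map f)))) t)
          = tail_map (tail_map (tail_map (tail_map (tail_map f)))) (P3 t)"
    and "B3 (tail_map (tail_map (tail_map (tail_map (tail_map f)))) t)
          = tail_map (tail_map (tail_map (tail_map f))) (B3 t)"
  by (simp_all add: tail_map_comp heads_linear heads_compose assms interchange0)

section \<open>The axioms as identities between words\<close>

text \<open>In the axioms the last strand is bare, with no tensor factor after it. A map that
  reaches this strand therefore appears as \<open>tail_map\<close> of the structure map itself and
  not as \<open>D1\<close>, \<open>P1\<close> or \<open>B1\<close>.\<close>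

lemma heads_base:
  "(\<Delta> \<otimes>\<^sub>m id) x = assoc_left (D0 x)"
  "(id \<otimes>\<^sub>m f) y = tail_map f y"
  "(br \<otimes>\<^sub>m id) (assoc_left z) = B0 z"
  "leg12 \<Psi>\<^sub>0 w = P0 w"
  "leg23 \<Psi>\<^sub>0 w' = tail_map \<Psi>\<^sub>0 w'"
  by (simp_all add: comult_head_def assoc_left_right tail_map_def bracket_head_def leg12_def
      braiding_head_def leg23_def)

text \<open>Two parallel brackets can be applied one after the other, the left one first; its output
  is a single strand, so the right one then sits at index 1.\<close>

lemma brackets_assoc_left: "(br \<otimes>\<^sub>m br) (assoc_left t) = tail_map br (B0 t)"
proof (rule clinear_eqI2[where t = t])
  show "clinear (\<lambda>t. (br \<otimes>\<^sub>m br) (assoc_left t))"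
    by (rule clinear_compose[OF clinear_tensor_map assoc_left(1)]) (fact structure_maps_linear)+
  show "clinear (\<lambda>t. tail_map br (B0 t))"
    by (intro heads_compose heads_linear clinear_id)
qed (simp add: heads_append assoc_left_tail_map_elem tensor_map_elem structure_maps_linear tail_map_elem)

lemma comults_assoc_right: "assoc_right ((\<Delta> \<otimes>\<^sub>m \<Delta>) t) = D0 (tail_map \<Delta> t)"
proof (rule clinear_eqI[where t = t])
  show "clinear (\<lambda>t. assoc_right ((\<Delta> \<otimes>\<^sub>m \<Delta>) t))"
    by (rule clinear_compose[OF assoc_right(1) clinear_tensor_map]) (fact structure_maps_linear)+
  show "clinear (\<lambda>t. D0 (tail_map \<Delta> t))"
    by (intro heads_compose heads_linear clinear_id)
qed (simp add: heads_append assoc_right_elem tensor_map_elem structure_maps_linear tail_map_elem)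

text \<open>Appending a strand turns maps that reach the bare last strand into the indexed maps,
  which is how an axiom is carried over to longer tensor products.\<close>

lemma interchange_append:
  fixes x :: "'a \<otimes> 'a" and y :: "'a \<otimes> 'a \<otimes> 'a"
  shows "D1 (tail_map (\<lambda>x. x \<otimes>\<^sub>v r) x) = tail_map (tail_map (\<lambda>x. x \<otimes>\<^sub>v r)) (tail_map \<Delta> x)"
    and "D2 (tail_map (tail_map (\<lambda>x. x \<otimes>\<^sub>v r)) y)
          = tail_map (tail_map (tail_map (\<lambda>x. x \<otimes>\<^sub>v r))) (tail_map (tail_map \<Delta>) y)"
    and "P1 (tail_map (tail_map (\<lambda>x. x \<otimes>\<^sub>v r)) y)
          = tail_map (tail_map (\<lambda>x. x \<otimes>\<^sub>v r)) (tail_map \<Psi>\<^sub>0 y)"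
    and "B1 (tail_map (tail_map (\<lambda>x. x \<otimes>\<^sub>v r)) y) = tail_map (\<lambda>x. x \<otimes>\<^sub>v r) (tail_map br y)"
  by (simp_all add: tail_map_comp heads_linear heads_compose heads_append
      clinear_compose[OF clinear_tail_map] clinear_compose[OF clinear_tensor_elem(1)])

lemmas heads_append_simps = heads_append interchange_append interchange0 interchange1 heads_linear

lemma leg12_head: "leg12 \<Psi>\<^sub>0 = P0"
  by (simp add: fun_eq_iff leg12_def braiding_head_def)

lemmas axiom_simps = heads_base assoc_right_left middle_def leg12_head tail_map_def[symmetric]
  brackets_assoc_left assoc_left_right eq_assoc_left[OF comults_assoc_right]

text \<open>This and the following lemmas share one pattern: \<open>*\<close> is the axiom on
  exactly its own strands, and linearity reduces the general case to such a tensor with one appended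
  factor \<open>r\<close>.\<close>

lemma coassoc0: "D0 (D0 t) = D1 (D0 t)"
proof (rule clinear_eqI[where t = t])
  fix x :: 'a and r :: 'b
  have *: "D0 (\<Delta> x) = tail_map \<Delta> (\<Delta> x)"
    using fun_cong[OF coassoc, of x]
    by (simp add: axiom_simps)
  show "D0 (D0 (x \<otimes>\<^sub>v r)) = D1 (D0 (x \<otimes>\<^sub>v r))"
    by (simp add: heads_append_simps *)
qed (intro heads_compose heads_linear clinear_id)+

lemma comult_right0: "D1 (P0 t) = P0 (P1 (D0 t))"
proof (rule clinear_eqI2[where t = t])
  fix u :: "'a \<otimes> 'a" and r :: 'b
  have *: "tail_map \<Delta> (\<Psi>\<^sub>0 u) = P0 (tail_map \<Psi>\<^sub>0 (D0 u))"
    using fun_cong[OF comult_right, of u]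
    by (simp add: axiom_simps)
  show "D1 (P0 (tail_map (\<lambda>x. x \<otimes>\<^sub>v r) u)) = P0 (P1 (D0 (tail_map (\<lambda>x. x \<otimes>\<^sub>v r) u)))"
    by (simp add: heads_append_simps *)
qed (intro heads_compose heads_linear clinear_id)+

lemma comult_left0: "D0 (P0 t) = P1 (P0 (D1 t))"
proof (rule clinear_eqI2[where t = t])
  fix u :: "'a \<otimes> 'a" and r :: 'b
  have *: "D0 (\<Psi>\<^sub>0 u) = tail_map \<Psi>\<^sub>0 (P0 (tail_map \<Delta> u))"
    using fun_cong[OF comult_left, of u]
    by (simp add: axiom_simps)
  show "D0 (P0 (tail_map (\<lambda>x. x \<otimes>\<^sub>v r) u)) = P1 (P0 (D1 (tail_map (\<lambda>x. x \<otimes>\<^sub>v r) u)))"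
    by (simp add: heads_append_simps *)
qed (intro heads_compose heads_linear clinear_id)+

lemma bracket_left0: "P0 (B0 t) = B1 (P0 (P1 t))"
proof (rule clinear_eqI3[where t = t])
  fix v :: "'a \<otimes> 'a \<otimes> 'a" and r :: 'b
  have *: "\<Psi>\<^sub>0 (B0 v) = tail_map br (P0 (tail_map \<Psi>\<^sub>0 v))"
    using fun_cong[OF bracket_left, of v]
    by (simp add: axiom_simps)
  show "P0 (B0 (tail_map (tail_map (\<lambda>x. x \<otimes>\<^sub>v r)) v))
      = B1 (P0 (P1 (tail_map (tail_map (\<lambda>x. x \<otimes>\<^sub>v r)) v)))"
    by (simp add: heads_append_simps *)
qed (intro heads_compose heads_linear clinear_id)+

lemma bracket_right0: "P0 (B1 t) = B0 (P1 (P0 t))"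
proof (rule clinear_eqI3[where t = t])
  fix v :: "'a \<otimes> 'a \<otimes> 'a" and r :: 'b
  have *: "\<Psi>\<^sub>0 (tail_map br v) = B0 (tail_map \<Psi>\<^sub>0 (P0 v))"
    using fun_cong[OF bracket_right, of v]
    by (simp add: axiom_simps)
  show "P0 (B1 (tail_map (tail_map (\<lambda>x. x \<otimes>\<^sub>v r)) v))
      = B0 (P1 (P0 (tail_map (tail_map (\<lambda>x. x \<otimes>\<^sub>v r)) v)))"
    by (simp add: heads_append_simps *)
qed (intro heads_compose heads_linear clinear_id)+

lemma braid0: "P0 (P1 (P0 t)) = P1 (P0 (P1 t))"
proof (rule clinear_eqI3[where t = t])
  fix v :: "'a \<otimes> 'a \<otimes> 'a" and r :: 'b
  have *: "tail_map \<Psi>\<^sub>0 (P0 (tail_map \<Psi>\<^sub>0 v)) = P0 (tail_map \<Psi>\<^sub>0 (P0 v))"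
    using fun_cong[OF braid_relation, of v]
    by (simp add: axiom_simps)
  show "P0 (P1 (P0 (tail_map (tail_map (\<lambda>x. x \<otimes>\<^sub>v r)) v)))
      = P1 (P0 (P1 (tail_map (tail_map (\<lambda>x. x \<otimes>\<^sub>v r)) v)))"
    by (simp add: heads_append_simps *)
qed (intro heads_compose heads_linear clinear_id)+

lemma jacobi0: "B0 (B1 t) = B0 (B1 (B0 (P1 (D0 t))))"
proof (rule clinear_eqI3[where t = t])
  fix v :: "'a \<otimes> 'a \<otimes> 'a" and r :: 'b
  have *: "br (tail_map br v) = br (tail_map br (B0 (P1 (D0 v))))"
    using fun_cong[OF L1_jacobi, of v]
    by (simp add: axiom_simps)
  show "B0 (B1 (tail_map (tail_map (\<lambda>x. x \<otimes>\<^sub>v r)) v))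
      = B0 (B1 (B0 (P1 (D0 (tail_map (tail_map (\<lambda>x. x \<otimes>\<^sub>v r)) v)))))"
    by (simp add: heads_append_simps *)
qed (intro heads_compose heads_linear clinear_id)+

lemma cocommutative0: "P0 (B0 (P1 (D0 t))) = B1 (D0 t)"
proof (rule clinear_eqI2[where t = t])
  fix u :: "'a \<otimes> 'a" and r :: 'b
  have *: "\<Psi>\<^sub>0 (B0 (tail_map \<Psi>\<^sub>0 (D0 u))) = tail_map br (D0 u)"
    using fun_cong[OF L2_cocommutative, of u]
    by (simp add: axiom_simps)
  show "P0 (B0 (P1 (D0 (tail_map (\<lambda>x. x \<otimes>\<^sub>v r) u)))) = B1 (D0 (tail_map (\<lambda>x. x \<otimes>\<^sub>v r) u))"
    by (simp add: heads_append_simps *)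
qed (intro heads_compose heads_linear clinear_id)+

text \<open>The coproduct of the second input has index 2 because the first coproduct has already
  added a strand in front of it.\<close>

lemma comult_bracket0: "D0 (B0 t) = B1 (B0 (P1 (D2 (D0 t))))"
proof (rule clinear_eqI2[where t = t])
  fix u :: "'a \<otimes> 'a" and r :: 'b
  have *: "\<Delta> (br u) = tail_map br (B0 (P1 (D0 (tail_map \<Delta> u))))"
    using fun_cong[OF L3_comult, of u]
    by (simp add: axiom_simps)
  show "D0 (B0 (tail_map (\<lambda>x. x \<otimes>\<^sub>v r) u)) = B1 (B0 (P1 (D2 (D0 (tail_map (\<lambda>x. x \<otimes>\<^sub>v r) u)))))"
    by (simp add: heads_append_simps *)
qed (intro heads_compose heads_linear clinear_id)+

section \<open>The same identities further to the right\<close>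

lemma coassoc1: "D1 (D1 t) = D2 (D1 t)"
  by (simp add: tail_map_comp heads_linear heads_compose coassoc0)

lemma comult_right1: "D2 (P1 t) = P1 (P2 (D1 t))"
  by (simp add: tail_map_comp heads_linear heads_compose comult_right0)

lemma comult_right2: "D3 (P2 t) = P2 (P3 (D2 t))"
  by (simp add: tail_map_comp heads_linear heads_compose comult_right0)

lemma comult_left2: "D2 (P2 t) = P3 (P2 (D3 t))"
  by (simp add: tail_map_comp heads_linear heads_compose comult_left0)

lemma comult_left3: "D3 (P3 t) = P4 (P3 (D4 t))"
  by (simp add: tail_map_comp heads_linear heads_compose comult_left0)

lemma bracket_left2: "P2 (B2 t) = B3 (P2 (P3 t))"
  by (simp add: tail_map_comp heads_linear heads_compose bracket_left0)

lemma bracket_right1: "P1 (B2 t) = B1 (P2 (P1 t))"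
  by (simp add: tail_map_comp heads_linear heads_compose bracket_right0)

lemma braid3: "P3 (P4 (P3 t)) = P4 (P3 (P4 t))"
  by (simp add: tail_map_comp heads_linear heads_compose braid0)

lemma cocommutative1: "P1 (B1 (P2 (D1 t))) = B2 (D1 t)"
  by (simp add: tail_map_comp heads_linear heads_compose cocommutative0)

text \<open>As rewrite rules these push the map further left inwards, so that it is applied earlier.
  A later step by \<open>interchange\<close> brings both of its sides to this order and can thus
  reshuffle in either direction.\<close>

lemmas interchange = interchange0 interchange1 interchange2 interchange3
  clinear_heads[OF structure_maps_linear] clinear_tail_map

text \<open>Both sides are the fourfold coproduct of the first strand. The left form splits copies 1
  and 2 last, as the Jacobi identity needs; the right form splits copies 2 and 3 last, as
  cocommutativity needs.\<close>

lemma comult_four: "D0 (D1 (D0 t)) = D1 (D1 (D0 t))"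
proof -
  have "D0 (D1 (D0 t)) = D2 (D0 (D0 t))"
    by (simp only: interchange)
  also have "\<dots> = D1 (D1 (D0 t))"
    by (simp only: coassoc0 coassoc1)
  finally show ?thesis .
qed

text \<open>The common normal form is the diagram of \<open>[x\<^sub>1, [y\<^sub>1, z]] \<otimes> [x\<^sub>2, y\<^sub>2] \<otimes> x\<^sub>3\<close>.\<close>

lemma braid_relation_left: "B1 (P2 (D1 (B0 (P1 (D0 (B1 (P2 (D1 t))))))))
    = B0 (B1 (B3 (P4 (P2 (P3 (P4 (P1 (P2 (D3 (D1 (D0 t)))))))))))"
proof -
  have "B1 (P2 (D1 (B0 (P1 (D0 (B1 (P2 (D1 t)))))))) = B0 (B2 (P3 (D2 (P1 (B2 (D0 (P2 (D1 t))))))))"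
    by (simp only: interchange)
  \<comment> \<open>From here on, naturality of the braiding moves the brackets outwards and the
    coproducts inwards; none of (L1) to (L3) enters on this side.\<close>
  also have "\<dots> = B0 (B2 (P3 (D2 (B1 (P2 (P1 (D0 (P2 (D1 t)))))))))"
    by (simp only: bracket_right1)
  also have "\<dots> = B0 (B1 (B3 (P4 (D3 (P2 (P1 (P3 (D2 (D0 t)))))))))"
    by (simp only: interchange)
  also have "\<dots> = B0 (B1 (B3 (P4 (P2 (P3 (D2 (P1 (P3 (D2 (D0 t))))))))))"
    by (simp only: comult_right2)
  also have "\<dots> = B0 (B1 (B3 (P4 (P2 (P3 (P4 (D2 (P1 (D2 (D0 t))))))))))"
    by (simp only: interchange)
  also have "\<dots> = B0 (B1 (B3 (P4 (P2 (P3 (P4 (P1 (P2 (D1 (D2 (D0 t)))))))))))"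
    by (simp only: comult_right1)
  also have "\<dots> = B0 (B1 (B3 (P4 (P2 (P3 (P4 (P1 (P2 (D3 (D1 (D0 t)))))))))))"
    by (simp only: interchange)
  finally show ?thesis .
qed

text \<open>(L3), (L2) and (L1) are used once each, in this order. In between, interchange,
  naturality and coassociativity produce the shape that the next axiom requires, and the braid
  relation of \<open>\<Psi>\<^sub>0\<close> settles the crossings left at the end.\<close>

lemma braid_relation_right: "B0 (P1 (D0 (B1 (P2 (D1 (B0 (P1 (D0 t))))))))
    = B0 (B1 (B3 (P4 (P2 (P3 (P4 (P1 (P2 (D3 (D1 (D0 t)))))))))))"
proof -
  have "B0 (P1 (D0 (B1 (P2 (D1 (B0 (P1 (D0 t)))))))) = B0 (P1 (D0 (B0 (B2 (P3 (D2 (P1 (D0 t))))))))"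
    by (simp only: interchange)
  \<comment> \<open>(L3): the outermost crossing splits its first strand, which is the bracket
    produced by the innermost crossing.\<close>
  also have "\<dots> = B0 (P1 (B1 (B0 (P1 (D2 (D0 (B2 (P3 (D2 (P1 (D0 t)))))))))))"
    by (simp only: comult_bracket0)
  also have "\<dots> = B0 (P1 (B2 (B1 (B0 (P1 (D2 (D0 (P3 (D2 (P1 (D0 t)))))))))))"
    by (simp only: interchange)
  also have "\<dots> = B0 (B1 (P2 (P1 (B1 (B0 (P1 (D2 (D0 (P3 (D2 (P1 (D0 t))))))))))))"
    by (simp only: bracket_right1)
  also have "\<dots> = B0 (B1 (P2 (P1 (B1 (B0 (P1 (D2 (D0 (P3 (P1 (P2 (D1 (D0 t)))))))))))))"
    by (simp only: comult_right1)
  also have "\<dots> = B0 (B1 (P2 (P1 (B1 (B0 (P1 (P5 (D2 (P2 (P3 (D0 (D1 (D0 t)))))))))))))"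
    by (simp only: interchange)
  also have "\<dots> = B0 (B1 (P2 (P1 (B1 (B0 (P1 (P5 (P3 (P2 (P4 (P3 (D4 (D0 (D1 (D0 t)))))))))))))))"
    by (simp only: comult_left2 comult_left3)
  \<comment> \<open>Now copies 2 and 3 of the first strand come from one coproduct, so
    cocommutativity can act on them.\<close>
  also have "\<dots> = B0 (B1 (P2 (P1 (B1 (B0 (P1 (P5 (P3 (P2 (P4 (P3 (D4 (D1 (D1 (D0 t)))))))))))))))"
    by (simp only: comult_four)
  also have "\<dots> = B0 (B1 (P2 (P1 (B1 (B0 (P5 (P3 (P4 (P1 (P2 (D1 (P2 (D3 (D1 (D0 t)))))))))))))))"
    by (simp only: interchange)
  \<comment> \<open>Naturality is read from right to left: the coproduct moves outwards again, which
    completes the pattern \<open>P1 (B1 (P2 (D1 _)))\<close> of (L2) after an interchange.\<close>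
  also have "\<dots> = B0 (B1 (P2 (P1 (B1 (B0 (P5 (P3 (P4 (D2 (P1 (P2 (D3 (D1 (D0 t))))))))))))))"
    by (simp only: comult_right1)
  also have "\<dots> = B0 (B1 (P2 (P3 (P1 (B1 (P2 (D1 (B0 (P3 (P1 (P2 (D3 (D1 (D0 t))))))))))))))"
    by (simp only: interchange)
  \<comment> \<open>(L2) exchanges the roles of copies 2 and 3 and absorbs a crossing.\<close>
  also have "\<dots> = B0 (B1 (P2 (P3 (B2 (D1 (B0 (P3 (P1 (P2 (D3 (D1 (D0 t))))))))))))"
    by (simp only: cocommutative1)
  also have "\<dots> = B0 (B1 (P2 (B2 (P4 (D1 (B0 (P3 (P1 (P2 (D3 (D1 (D0 t))))))))))))"
    by (simp only: interchange)
  also have "\<dots> = B0 (B1 (B3 (P2 (P3 (P4 (D1 (B0 (P3 (P1 (P2 (D3 (D1 (D0 t)))))))))))))"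
    by (simp only: bracket_left2)
  also have "\<dots> = B0 (B1 (B0 (B4 (P3 (P4 (P5 (P4 (D2 (P1 (P2 (D3 (D1 (D0 t)))))))))))))"
    by (simp only: interchange)
  also have "\<dots> = B0 (B1 (B0 (B4 (P3 (P4 (P5 (P4 (P1 (P2 (D1 (P2 (D3 (D1 (D0 t))))))))))))))"
    by (simp only: comult_right1)
  also have "\<dots> = B0 (B1 (B0 (P1 (B4 (P3 (P4 (P5 (P4 (P2 (P3 (D4 (D1 (D1 (D0 t))))))))))))))"
    by (simp only: interchange)
  \<comment> \<open>Regrouping the coproduct so that copies 1 and 2 are split last prepares the
    pattern \<open>B0 (B1 (B0 (P1 (D0 _))))\<close>, which (L1) contracts.\<close>
  also have "\<dots> = B0 (B1 (B0 (P1 (B4 (P3 (P4 (P5 (P4 (P2 (P3 (D4 (D0 (D1 (D0 t))))))))))))))"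
    by (simp only: comult_four)
  also have "\<dots> = B0 (B1 (B0 (P1 (D0 (B3 (P2 (P3 (P4 (P3 (P1 (P2 (D3 (D1 (D0 t))))))))))))))"
    by (simp only: interchange)
  also have "\<dots> = B0 (B1 (B3 (P2 (P3 (P4 (P3 (P1 (P2 (D3 (D1 (D0 t)))))))))))"
    by (simp only: jacobi0[symmetric])
  \<comment> \<open>Only the order of three background crossings still differs from the normal
    form.\<close>
  also have "\<dots> = B0 (B1 (B3 (P2 (P4 (P3 (P4 (P1 (P2 (D3 (D1 (D0 t)))))))))))"
    by (simp only: braid3)
  also have "\<dots> = B0 (B1 (B3 (P4 (P2 (P3 (P4 (P1 (P2 (D3 (D1 (D0 t)))))))))))"
    by (simp only: interchange)
  finally show ?thesis .
qed

section \<open>From words back to the braiding on the triple tensor product\<close>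

lemma bracket_braiding_heads: "bracket_braiding \<Delta> \<Psi>\<^sub>0 br u = B0 (tail_map \<Psi>\<^sub>0 (D0 u))"
  by (simp add: bracket_braiding_def heads_base assoc_right_left)

lemma clinear_bracket_braiding: "clinear (bracket_braiding \<Delta> \<Psi>\<^sub>0 br)"
  unfolding bracket_braiding_heads[abs_def] by (intro heads_compose heads_linear clinear_id)

lemma braiding_head_bracket_braiding:
  "braiding_head (bracket_braiding \<Delta> \<Psi>\<^sub>0 br) t = B0 (P1 (D0 t))"
proof (rule clinear_eqI2[where t = t])
  show "clinear (braiding_head (bracket_braiding \<Delta> \<Psi>\<^sub>0 br))"
    by (rule clinear_heads[OF linear_comult clinear_bracket_braiding linear_bracket])
  fix u :: "'a \<otimes> 'a" and r :: 'b
  show "braiding_head (bracket_braiding \<Delta> \<Psi>\<^sub>0 br) (tail_map (\<lambda>x. x \<otimes>\<^sub>v r) u)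
      = B0 (P1 (D0 (tail_map (\<lambda>x. x \<otimes>\<^sub>v r) u)))"
    by (simp add: heads_elem[OF linear_comult clinear_bracket_braiding linear_bracket]
        heads_append_simps bracket_braiding_heads)
qed (intro heads_compose heads_linear clinear_id)

lemma braiding_bracket_braiding: "braiding (bracket_braiding \<Delta> \<Psi>\<^sub>0 br)"
proof (rule braiding.intro)
  let ?\<Phi> = "bracket_braiding \<Delta> \<Psi>\<^sub>0 br"
  \<comment> \<open>The word identities need a strand to the right of the three; it is filled with
    the scalar 1. Since \<open>unit_right\<close> removes it again, no information is lost.\<close>
  define app :: "'a \<Rightarrow> 'a \<otimes> complex" where "app = (\<lambda>x. x \<otimes>\<^sub>v 1)"
  have app: "clinear app"
    unfolding app_def by (rule clinear_tensor_elem)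
  note lin = linear_comult clinear_bracket_braiding linear_bracket
  note lins = clinear_heads[OF lin] clinear_tail_map lin app
  have inj: "tail_map (tail_map unit_right) (tail_map (tail_map app) v) = v" for v :: "'a \<otimes> 'a \<otimes> 'a"
    by (simp add: tail_map_comp lins clinear_unit_right)
      (simp add: app_def unit_right_elem scaleC_one tail_map_ident)
  have head: "braiding_head ?\<Phi> (tail_map app u) = tail_map app (?\<Phi> u)" for u
    unfolding app_def by (rule heads_elem[OF lin])
  have head': "tail_map (braiding_head ?\<Phi>) (tail_map (tail_map app) v)
        = tail_map (tail_map app) (tail_map ?\<Phi> v)"
    for v :: "'a \<otimes> 'a \<otimes> 'a"
    by (simp add: tail_map_comp lins head)
  have braid: "tail_map (braiding_head ?\<Phi>) (braiding_head ?\<Phi> (tail_map (braiding_head ?\<Phi>) t))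
      = braiding_head ?\<Phi> (tail_map (braiding_head ?\<Phi>) (braiding_head ?\<Phi> t))"
    for t :: "'a \<otimes> 'a \<otimes> 'a \<otimes> complex"
  proof -
    have 1: "tail_map (braiding_head ?\<Phi>) s = B1 (P2 (D1 s))" for s :: "'a \<otimes> 'a \<otimes> 'a \<otimes> complex"
      unfolding braiding_head_bracket_braiding[abs_def]
      by (simp add: tail_map_comp heads_linear heads_compose)
    show ?thesis
      unfolding 1 unfolding braiding_head_bracket_braiding
      by (simp only: braid_relation_left braid_relation_right)
  qed
  have leg12: "leg12 ?\<Phi> v = braiding_head ?\<Phi> v" for v
    by (simp add: leg12_def braiding_head_def)
  have leg23: "leg23 ?\<Phi> v = tail_map ?\<Phi> v" for v
    by (simp add: leg23_def tail_map_def)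
  show "clinear ?\<Phi>" by (rule clinear_bracket_braiding)
  show "leg23 ?\<Phi> \<circ> leg12 ?\<Phi> \<circ> leg23 ?\<Phi> = leg12 ?\<Phi> \<circ> leg23 ?\<Phi> \<circ> leg12 ?\<Phi>"
  proof
    fix v :: "'a \<otimes> 'a \<otimes> 'a"
    have "tail_map (tail_map app) (tail_map ?\<Phi> (braiding_head ?\<Phi> (tail_map ?\<Phi> v)))
        = tail_map (tail_map app) (braiding_head ?\<Phi> (tail_map ?\<Phi> (braiding_head ?\<Phi> v)))"
      using braid[of "tail_map (tail_map app) v"]
      by (simp add: head' interchange_heads[OF lin] app)
    then show "(leg23 ?\<Phi> \<circ> leg12 ?\<Phi> \<circ> leg23 ?\<Phi>) v = (leg12 ?\<Phi> \<circ> leg23 ?\<Phi> \<circ> leg12 ?\<Phi>) v"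
      using inj by (metis comp_apply leg12 leg23)
  qed
qed

end


section \<open>Quotients of the tensor algebra\<close>

lemma tensor_alg_simps [simp]:
  "carrier tensor_alg = UNIV" "a \<otimes>\<^bsub>tensor_alg\<^esub> b = a * b" "\<one>\<^bsub>tensor_alg\<^esub> = 1"
  "\<zero>\<^bsub>tensor_alg\<^esub> = 0" "a \<oplus>\<^bsub>tensor_alg\<^esub> b = a + b" "c \<odot>\<^bsub>tensor_alg\<^esub> a = c *\<^sub>C a"
  by (simp_all add: tensor_alg_def)

lemma ring_tensor_alg: "Ring.ring tensor_alg"
proof (rule ringI)
  show "abelian_group (tensor_alg :: (complex, 'a tensor_algebra) module)"
    by (rule abelian_groupI) (auto simp: add.assoc add.commute intro: exI[of _ "- _"] left_minus)
  show "monoid (tensor_alg :: (complex, 'a tensor_algebra) module)"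
    by (rule monoidI) (auto simp: mult.assoc)
qed (auto simp: distrib_left distrib_right)

lemma complex_algebraI:
  assumes "Ring.ring A"
    and "\<And>c x. x \<in> carrier A \<Longrightarrow> c \<odot>\<^bsub>A\<^esub> x \<in> carrier A"
    and "\<And>c d x. x \<in> carrier A \<Longrightarrow> (c + d) \<odot>\<^bsub>A\<^esub> x = c \<odot>\<^bsub>A\<^esub> x \<oplus>\<^bsub>A\<^esub> d \<odot>\<^bsub>A\<^esub> x"
    and "\<And>c x y. x \<in> carrier A \<Longrightarrow> y \<in> carrier A \<Longrightarrow> c \<odot>\<^bsub>A\<^esub> (x \<oplus>\<^bsub>A\<^esub> y) = c \<odot>\<^bsub>A\<^esub> x \<oplus>\<^bsub>A\<^esub> c \<odot>\<^bsub>A\<^esub> y"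
    and "\<And>c d x. x \<in> carrier A \<Longrightarrow> (c * d) \<odot>\<^bsub>A\<^esub> x = c \<odot>\<^bsub>A\<^esub> (d \<odot>\<^bsub>A\<^esub> x)"
    and "\<And>x. x \<in> carrier A \<Longrightarrow> 1 \<odot>\<^bsub>A\<^esub> x = x"
    and "\<And>c x y. x \<in> carrier A \<Longrightarrow> y \<in> carrier A \<Longrightarrow> (c \<odot>\<^bsub>A\<^esub> x) \<otimes>\<^bsub>A\<^esub> y = c \<odot>\<^bsub>A\<^esub> (x \<otimes>\<^bsub>A\<^esub> y)"
    and "\<And>c x y. x \<in> carrier A \<Longrightarrow> y \<in> carrier A \<Longrightarrow> x \<otimes>\<^bsub>A\<^esub> (c \<odot>\<^bsub>A\<^esub> y) = c \<odot>\<^bsub>A\<^esub> (x \<otimes>\<^bsub>A\<^esub> y)"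
  shows "complex_algebra A"
proof -
  interpret Ring.ring A by fact
  interpret C: Ring.cring "ring_of_type_algebra :: complex ring" by (rule cring_from_type_algebra)
  show ?thesis
    by unfold_locales (use assms in \<open>auto simp: ring_of_type_algebra_def\<close>)
qed

section \<open>The quotient algebra and its operations on representatives\<close>

text \<open>Every element of \<open>A\<close> is an image under \<open>q\<close>, so each ring law
  of \<open>T\<close> is inherited; negatives are images of negatives.\<close>

lemma ring_onto:
  assumes ring: "Ring.ring T" and carrier: "carrier A = q ` carrier T"
    and q: "\<And>a b. a \<in> carrier T \<Longrightarrow> b \<in> carrier T \<Longrightarrow> q a \<otimes>\<^bsub>A\<^esub> q b = q (a \<otimes>\<^bsub>T\<^esub> b)"
      "\<And>a b. a \<in> carrier T \<Longrightarrow> b \<in> carrier T \<Longrightarrow> q a \<oplus>\<^bsub>A\<^esub> q b = q (a \<oplus>\<^bsub>T\<^esub> b)"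
      "\<one>\<^bsub>A\<^esub> = q \<one>\<^bsub>T\<^esub>" "\<zero>\<^bsub>A\<^esub> = q \<zero>\<^bsub>T\<^esub>"
  shows "Ring.ring A"
proof -
  interpret T: Ring.ring T by fact
  show ?thesis
  proof (rule ringI)
    show "abelian_group A"
    proof (rule abelian_groupI)
      fix x assume "x \<in> carrier A"
      then obtain a where "a \<in> carrier T" "x = q a" by (auto simp: carrier)
      then show "\<exists>y\<in>carrier A. y \<oplus>\<^bsub>A\<^esub> x = \<zero>\<^bsub>A\<^esub>"
        by (intro bexI[of _ "q (\<ominus>\<^bsub>T\<^esub> a)"]) (auto simp: carrier q T.l_neg)
    qed (auto simp: carrier q T.a_ac)
    show "monoid A"
      by (rule monoidI) (auto simp: carrier q T.m_assoc)
  qed (auto simp: carrier q T.l_distr T.r_distr)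
qed

context
  fixes I :: "'a::complex_vector tensor_algebra set"
  assumes ideal: "Ideal.ideal I tensor_alg"
begin

interpretation I: Ideal.ideal I tensor_alg by (rule ideal)

text \<open>Scaling by \<open>c\<close> is multiplication by \<open>c *\<^sub>C 1\<close>, so a ring
  ideal is automatically a subspace.\<close>

lemma ideal_scaleC: "a \<in> I \<Longrightarrow> c *\<^sub>C a \<in> I"
  using I.I_l_closed[of a "c *\<^sub>C 1"] by (simp add: mult_scaleC_left)

lemma rcoset_eq_iff: "I +>\<^bsub>tensor_alg\<^esub> a = I +>\<^bsub>tensor_alg\<^esub> b \<longleftrightarrow> a - b \<in> I"
proof
  assume "I +>\<^bsub>tensor_alg\<^esub> a = I +>\<^bsub>tensor_alg\<^esub> b"
  then have "a \<in> I +>\<^bsub>tensor_alg\<^esub> b"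
    using I.a_rcos_self[of a] by simp
  then show "a - b \<in> I" by (auto simp: a_r_coset_def')
next
  assume "a - b \<in> I"
  then have "a \<in> I +>\<^bsub>tensor_alg\<^esub> b"
    by (auto simp: a_r_coset_def' intro!: bexI[of _ "a - b"])
  then show "I +>\<^bsub>tensor_alg\<^esub> a = I +>\<^bsub>tensor_alg\<^esub> b"
    by (metis I.a_repr_independence UNIV_I tensor_alg_simps(1) I.a_subgroup)
qed

text \<open>All representatives give the same scaled coset, and there is at least one, so the union
  in the definition of scalar multiplication collapses.\<close>

lemma smult_rcoset: "(\<Union>x\<in>I +>\<^bsub>tensor_alg\<^esub> a. I +>\<^bsub>tensor_alg\<^esub> (c *\<^sub>C x)) = I +>\<^bsub>tensor_alg\<^esub> (c *\<^sub>C a)"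
proof -
  have "I +>\<^bsub>tensor_alg\<^esub> (c *\<^sub>C x) = I +>\<^bsub>tensor_alg\<^esub> (c *\<^sub>C a)" if "x \<in> I +>\<^bsub>tensor_alg\<^esub> a" for x
  proof -
    have "x - a \<in> I" using that by (auto simp: a_r_coset_def')
    from ideal_scaleC[OF this] show ?thesis
      by (simp add: rcoset_eq_iff complex_vector.scale_right_diff_distrib)
  qed
  moreover have "a \<in> I +>\<^bsub>tensor_alg\<^esub> a" by (rule I.a_rcos_self) simp
  ultimately show ?thesis by blast
qed

lemma algebra_quotient_simps:
  "carrier (algebra_quotient tensor_alg I) = range ((+>\<^bsub>tensor_alg\<^esub>) I)"
  "(I +>\<^bsub>tensor_alg\<^esub> a) \<otimes>\<^bsub>algebra_quotient tensor_alg I\<^esub> (I +>\<^bsub>tensor_alg\<^esub> b) = I +>\<^bsub>tensor_alg\<^esub> (a * b)"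
  "(I +>\<^bsub>tensor_alg\<^esub> a) \<oplus>\<^bsub>algebra_quotient tensor_alg I\<^esub> (I +>\<^bsub>tensor_alg\<^esub> b) = I +>\<^bsub>tensor_alg\<^esub> (a + b)"
  "\<one>\<^bsub>algebra_quotient tensor_alg I\<^esub> = I +>\<^bsub>tensor_alg\<^esub> 1"
  "\<zero>\<^bsub>algebra_quotient tensor_alg I\<^esub> = I +>\<^bsub>tensor_alg\<^esub> 0"
  "c \<odot>\<^bsub>algebra_quotient tensor_alg I\<^esub> (I +>\<^bsub>tensor_alg\<^esub> a) = I +>\<^bsub>tensor_alg\<^esub> (c *\<^sub>C a)"
  using I.rcoset_mult_add[of a b] I.a_rcos_sum[of a b] smult_rcoset[of c a]
  by (auto simp: algebra_quotient_def FactRing_def ring.defs A_RCOSETS_def' a_r_coset_def')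

lemma complex_algebra_quotient: "complex_algebra (algebra_quotient tensor_alg I)"
  by (rule complex_algebraI[OF ring_onto[OF ring_tensor_alg, of _ "(+>\<^bsub>tensor_alg\<^esub>) I"]])
    (auto simp: algebra_quotient_simps scaleC_add_left scaleC_add_right scaleC_scaleC scaleC_one
      mult_scaleC_left mult_scaleC_right)

lemma rcoset_algebra_hom:
  "(+>\<^bsub>tensor_alg\<^esub>) I \<in> algebra_hom tensor_alg (algebra_quotient tensor_alg I)"
  by (auto simp: algebra_hom_def algebra_quotient_simps intro!: ring_hom_memI)

lemma a_kernel_rcoset: "a_kernel tensor_alg (algebra_quotient tensor_alg I) ((+>\<^bsub>tensor_alg\<^esub>) I) = I"
  by (auto simp: a_kernel_def' algebra_quotient_simps rcoset_eq_iff)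

end

section \<open>Generation and presentation of the quotient\<close>

lemma abs_tensor_algebra_word:
  "abs_tensor_algebra (Poly_Mapping.single (Word xs) 1) = prod_list (map talg_gen xs)"
proof (induction xs)
  case Nil
  show ?case
    by (simp add: one_tensor_algebra.abs_eq zero_word_def[symmetric])
next
  case (Cons x xs)
  have "Poly_Mapping.single (Word (x # xs)) (1::complex) = letter x * Poly_Mapping.single (Word xs) 1"
    by (simp add: letter_def mult_single plus_word_def)
  then show ?case
    by (simp add: Cons.IH times_tensor_algebra.abs_eq[symmetric] talg_gen.abs_eq[symmetric])
qed

text \<open>The words span the free algebra, and each word becomes a product of generators in the
  quotient. This yields generation by 1 and the vector space.\<close>

lemma tensor_algebra_induct [case_names one gen add mult scale]:
  assumes one: "P 1" and gen: "\<And>x. P (talg_gen x)"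
    and add: "\<And>a b. P a \<Longrightarrow> P b \<Longrightarrow> P (a + b)" and mult: "\<And>a b. P a \<Longrightarrow> P b \<Longrightarrow> P (a * b)"
    and scale: "\<And>c a. P a \<Longrightarrow> P (c *\<^sub>C a)"
  shows "P a"
proof -
  have abs: "clinear (abs_tensor_algebra :: ('a word \<Rightarrow>\<^sub>0 complex) \<Rightarrow> _)"
    by (rule clinearI) (simp_all add: plus_tensor_algebra.abs_eq scaleC_tensor_algebra.abs_eq)
  have words: "P (prod_list (map talg_gen xs))" for xs
    by (induction xs) (auto intro: one gen mult)
  have words': "abs_tensor_algebra (Poly_Mapping.single k 1) = prod_list (map talg_gen (letters k))"
    for k :: "'a word"
    using abs_tensor_algebra_word[of "letters k"] by simp
  have zero: "P 0"
    using scale[OF one, of 0] by simp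
  have sums: "P (\<Sum>k\<in>K. f k *\<^sub>C prod_list (map talg_gen (letters k)))" if "finite K" for K f
    using that by induction (auto intro: zero add scale words)
  have "a = abs_tensor_algebra (free_lift (\<lambda>k. Poly_Mapping.single k 1) (rep_tensor_algebra a))"
    by (simp add: poly_mapping_eq_free_lift Quotient3_abs_rep[OF Quotient3_tensor_algebra])
  also have "\<dots> = free_lift (\<lambda>k. abs_tensor_algebra (Poly_Mapping.single k 1)) (rep_tensor_algebra a)"
    by (rule clinear_free_lift_eq[OF abs])
  also have "\<dots> = free_lift (\<lambda>k. prod_list (map talg_gen (letters k))) (rep_tensor_algebra a)"
    by (simp add: words')
  finally have eq: "a = free_lift (\<lambda>k. prod_list (map talg_gen (letters k))) (rep_tensor_algebra a)" .
  show ?thesis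
    by (subst eq) (simp add: free_lift_def sums)
qed

text \<open>The coset map is the required homomorphism: its kernel is the ideal generated by
  \<open>R\<close>, and induction over the tensor algebra shows that every coset is generated. The
  argument applies to any set \<open>R\<close> of relations.\<close>

lemma generated_with_relations_quotient:
  fixes R :: "'a::complex_vector tensor_algebra set"
  defines "I \<equiv> Idl\<^bsub>tensor_alg\<^esub> R"
  shows "generated_with_relations (algebra_quotient tensor_alg I)
    (\<lambda>x. I +>\<^bsub>tensor_alg\<^esub> talg_gen x) R"
proof -
  have ideal: "Ideal.ideal I tensor_alg"
    unfolding I_def by (rule ring.genideal_ideal[OF ring_tensor_alg]) simp
  note simps = algebra_quotient_simps[OF ideal]
  let ?A = "algebra_quotient tensor_alg I" and ?i = "\<lambda>x. I +>\<^bsub>tensor_alg\<^esub> talg_gen x"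
  let ?G = "generated_algebra ?A (insert \<one>\<^bsub>?A\<^esub> (range ?i))"
  have "I +>\<^bsub>tensor_alg\<^esub> a \<in> ?G" for a
  proof (induction a rule: tensor_algebra_induct)
    case one
    then show ?case by (intro generated_algebra.gen) (simp add: simps)
  next
    case (add a b)
    from generated_algebra.add[OF this] show ?case by (simp add: simps)
  next
    case (mult a b)
    from generated_algebra.mult[OF this] show ?case by (simp add: simps)
  next
    case (scale c a)
    from generated_algebra.smult[OF this] show ?case by (simp add: simps)
  qed (auto intro: generated_algebra.gen)
  moreover have "x \<in> carrier ?A" if "x \<in> ?G" for x
    using that by induction (auto simp: simps)
  ultimately have "?G = carrier ?A"
    by (auto simp: simps)
  then show ?thesis
    unfolding generated_with_relations_def
    using complex_algebra_quotient[OF ideal] rcoset_algebra_hom[OF ideal] a_kernel_rcoset[OF ideal]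
    by (auto simp: I_def[symmetric])
qed

theorem theorem3p1:
  fixes \<Delta> :: "'a::complex_vector \<Rightarrow> 'a \<otimes> 'a"
    and \<epsilon> :: "'a \<Rightarrow> complex"
    and \<Psi>\<^sub>0 :: "'a \<otimes> 'a \<Rightarrow> 'a \<otimes> 'a"
    and br :: "'a \<otimes> 'a \<Rightarrow> 'a"
  assumes "coalgebra \<Delta> \<epsilon>"
    and "compatible_braiding \<Delta> \<epsilon> \<Psi>\<^sub>0"
    and "clinear br"
    and "braided_lie_algebra \<Delta> \<epsilon> \<Psi>\<^sub>0 br"
  shows "braiding (bracket_braiding \<Delta> \<Psi>\<^sub>0 br) \<and>
    generated_with_relations (braided_enveloping_algebra \<Delta> \<Psi>\<^sub>0 br) (enveloping_gen \<Delta> \<Psi>\<^sub>0 br)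
      (product_relations (bracket_braiding \<Delta> \<Psi>\<^sub>0 br))"
proof
  interpret braided_lie_algebra \<Delta> \<epsilon> \<Psi>\<^sub>0 br by fact
  show "braiding (bracket_braiding \<Delta> \<Psi>\<^sub>0 br)"
    by (rule braiding_bracket_braiding)
  show "generated_with_relations (braided_enveloping_algebra \<Delta> \<Psi>\<^sub>0 br) (enveloping_gen \<Delta> \<Psi>\<^sub>0 br)
      (product_relations (bracket_braiding \<Delta> \<Psi>\<^sub>0 br))"
    using generated_with_relations_quotient[of "product_relations (bracket_braiding \<Delta> \<Psi>\<^sub>0 br)"]
    by (simp add: braided_enveloping_algebra_def enveloping_gen_def[abs_def] enveloping_ideal_def
        bracket_braiding_def)
qed

end
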